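(* For every finite alphabet $A$ with $|A|\ge 2$ there exists a bound $K\in\mathbb{N}$ such that the symmetric Post Correspondence Problem over $A$, restricted to inputs consisting of at most $K$ pairs, is undecidable. That is, there is no algorithm which, given a non-empty finite symmetric set $\{(u_i,v_i): 0\le i<k\}$ of ordered pairs of strings in $A^*$ with $k\le K$ and $u_i\ne v_i$ for all $i$, decides whether there exists a non-empty finite sequence $(j_1,\ldots,j_n)$ of elements of $\{0,\ldots,k-1\}$ such that $u_{j_1}\cdots u_{j_n}=v_{j_1}\cdots v_{j_n}$.
   Context: $A^*$ is the set of all finite strings over $A$, including the empty string $\varepsilon$; concatenation is written as juxtaposition. The Post Correspondence Problem (PCP) over $A$ is the following decision problem. Input: a non-empty finite set $\{(u_i,v_i):0\le i<k\}$ of ordered pairs of strings in $A^*$, $k>0$. Question: is there a non-empty finite sequence $(j_1,\ldots,j_n)$ of numbers in $\{0,\ldots,k-1\}$ with $u_{j_1}\cdots u_{j_n}=v_{j_1}\cdots v_{j_n}$? Non-triviality assumption: inputs are assumed to satisfy $u_i\neq v_i$ for all $i$. The PCP is called bounded if some upper bound on $k$ has been fixed beforehand. The symmetric PCP is the PCP with the additional restriction that the input set is a symmetric relation: whenever $(u,v)$ is in the set, so is $(v,u)$. *)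

theory Defs
  imports Main "HOL-Library.Nat_Bijection"
begin

text \<open>
  Algorithms are modelled by programs for the partial recursive functions. The value relation
  \<open>computes r xs y\<close> (program \<open>r\<close> halts on arguments \<open>xs\<close> with value \<open>y\<close>) leaves arities implicit:
  a program applied to an argument list for which it makes no sense computes no value.
  \<open>Zero\<close> is the constant zero function of every arity, and \<open>Proj\<close> counts arguments from \<open>0\<close>.
\<close>

datatype recf =
    Zero
  | Succ
  | Proj nat
  | Comp recf "recf list"
  | PrimRec recf recf
  | Mu recf

inductive computes :: "recf \<Rightarrow> nat list \<Rightarrow> nat \<Rightarrow> bool" where
  zero: "computes Zero xs 0"
| succ: "computes Succ [x] (Suc x)"
| proj: "i < length xs \<Longrightarrow> computes (Proj i) xs (xs ! i)"
| comp: "\<lbrakk>list_all2 (\<lambda>g y. computes g xs y) gs ys; computes f ys z\<rbrakk>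
    \<Longrightarrow> computes (Comp f gs) xs z"
| primrec_0: "computes f xs y \<Longrightarrow> computes (PrimRec f g) (0 # xs) y"
| primrec_Suc: "\<lbrakk>computes (PrimRec f g) (n # xs) y; computes g (n # y # xs) z\<rbrakk>
    \<Longrightarrow> computes (PrimRec f g) (Suc n # xs) z"
| mu: "\<lbrakk>computes f (n # xs) 0; \<forall>m<n. \<exists>k. computes f (m # xs) (Suc k)\<rbrakk>
    \<Longrightarrow> computes (Mu f) xs n"

text \<open>
  A decision problem has a set \<open>I\<close> of admissible inputs, presented to the algorithm through
  \<open>code\<close>, and a question \<open>Q\<close>. An algorithm has to halt with the right answer on the
  admissible inputs; nothing is required of it on other numbers.
\<close>

definition decidable_problem :: "('i \<Rightarrow> nat) \<Rightarrow> 'i set \<Rightarrow> ('i \<Rightarrow> bool) \<Rightarrow> bool" where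
  "decidable_problem code I Q \<longleftrightarrow>
     (\<exists>r. \<forall>x\<in>I. computes r [code x] (if Q x then 1 else 0))"

text \<open>
  The finite set \<open>{(u\<^sub>i, v\<^sub>i) : 0 \<le> i < k}\<close> is given by the list
  \<open>[(u\<^sub>0, v\<^sub>0), \<dots>, (u\<^sub>k\<^sub>-\<^sub>1, v\<^sub>k\<^sub>-\<^sub>1)]\<close> of its
  elements without repetition, so that \<open>k\<close> is both the length of the list and the
  cardinality of the set.
\<close>

type_synonym 'a pcp = "('a list \<times> 'a list) list"

definition pcp_input :: "'a set \<Rightarrow> 'a pcp \<Rightarrow> bool" where
  "pcp_input A ps \<longleftrightarrow> ps \<noteq> [] \<and> distinct ps \<and> set ps \<subseteq> lists A \<times> lists A
     \<and> (\<forall>i<length ps. fst (ps ! i) \<noteq> snd (ps ! i))"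

definition symmetric_pcp_input :: "'a set \<Rightarrow> 'a pcp \<Rightarrow> bool" where
  "symmetric_pcp_input A ps \<longleftrightarrow> pcp_input A ps \<and> sym (set ps)"

definition pcp_solvable :: "'a pcp \<Rightarrow> bool" where
  "pcp_solvable ps \<longleftrightarrow>
     (\<exists>js. js \<noteq> [] \<and> set js \<subseteq> {..<length ps}
        \<and> concat (map (\<lambda>j. fst (ps ! j)) js) = concat (map (\<lambda>j. snd (ps ! j)) js))"

text \<open>The letters of the alphabet are presented as numbers through \<open>num\<close>.\<close>

definition pcp_code :: "('a \<Rightarrow> nat) \<Rightarrow> 'a pcp \<Rightarrow> nat" where
  "pcp_code num ps = list_encode
     (map (\<lambda>(u, v). prod_encode (list_encode (map num u), list_encode (map num v))) ps)"

text \<open>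
  Since \<open>A\<close> is meant to be finite, the choice of numbering of its letters is immaterial;
  undecidability is required for every one of them, with the same bound \<open>K\<close>.
\<close>

definition bounded_symmetric_pcp_undecidable :: "'a set \<Rightarrow> nat \<Rightarrow> bool" where
  "bounded_symmetric_pcp_undecidable A K \<longleftrightarrow>
     (\<forall>num. inj_on num A \<longrightarrow>
        \<not> decidable_problem (pcp_code num)
            {ps. symmetric_pcp_input A ps \<and> length ps \<le> K} pcp_solvable)"

end

theory Submission
  imports Defs
begin

text \<open>
  A fixed word rewriting system with one head interprets arbitrary programs, given as words, so an
  instance of the correspondence problem depends on the program only through its initial pair and the
  number of pairs is constant. If \<open>r\<close> decided these instances, the program \<open>p\<close> that computes the
  instance asking whether program \<open>n\<close> returns \<open>0\<close> on input \<open>n\<close> and then applies \<open>r\<close> would return \<open>1\<close> on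
  its own code exactly if it returns \<open>0\<close> there. The interpreter is deterministic with distinct terminal words for
  the outcomes zero and nonzero, so only the forward simulation of halting computations is needed.

  Every pair \<open>(u, v)\<close> of a correspondence problem with prescribed first and last pair is spread out to
  \<open>(u\<^sub>1 # u\<^sub>2 # \<dots>, # v\<^sub>1 # v\<^sub>2 \<dots>)\<close>. The position of the separators forces all pairs of a solution to
  be used in the same orientation, which makes the symmetric closure harmless.
\<close>

section \<open>Correspondence problems over marked words\<close>

text \<open>The obstacle is that pairs may be mixed with their reversals: \<open>(u, v)\<close>
  followed by \<open>(v, u)\<close> is already a solution whenever \<open>u\<close> and
  \<open>v\<close> commute, and reversed rules would run a derivation backwards. The diagonal
  argument needs neither a numbering of \<open>recf\<close> programs nor a recursion theorem. The
  number that stands for a program is the list code of the final part of its coded initial word,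
  from the pointer sign on. List codes are built up from the tail, so putting a unary input in front
  of that part is arithmetic on this number, and one \<open>n\<close> can serve as program and as
  input. The supposed decider halts on every instance, so the program built from it halts as well,
  and diverging runs never have to be analysed. A numbering of the alphabet enters only into the
  program that computes the instance codes, never into the pairs; this is why one bound serves all
  numberings.\<close>

lemma pcp_solvable_iff:
  "pcp_solvable ps \<longleftrightarrow>
     (\<exists>qs. qs \<noteq> [] \<and> set qs \<subseteq> set ps \<and> concat (map fst qs) = concat (map snd qs))"
proof
  assume "pcp_solvable ps"
  then obtain js where js: "js \<noteq> []" "set js \<subseteq> {..<length ps}"
    "concat (map (\<lambda>j. fst (ps ! j)) js) = concat (map (\<lambda>j. snd (ps ! j)) js)"
    unfolding pcp_solvable_def by blast
  then have "map ((!) ps) js \<noteq> []" "set (map ((!) ps) js) \<subseteq> set ps"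
    "concat (map fst (map ((!) ps) js)) = concat (map snd (map ((!) ps) js))"
    by (auto simp: comp_def)
  then show "\<exists>qs. qs \<noteq> [] \<and> set qs \<subseteq> set ps \<and> concat (map fst qs) = concat (map snd qs)"
    by blast
next
  assume "\<exists>qs. qs \<noteq> [] \<and> set qs \<subseteq> set ps \<and> concat (map fst qs) = concat (map snd qs)"
  then obtain qs where qs: "qs \<noteq> []" "set qs \<subseteq> set ps" "concat (map fst qs) = concat (map snd qs)"
    by blast
  from qs(2) have "\<exists>js. set js \<subseteq> {..<length ps} \<and> map ((!) ps) js = qs"
  proof (induction qs)
    case (Cons q qs)
    then obtain js where js: "set js \<subseteq> {..<length ps}" "map ((!) ps) js = qs" by auto
    from Cons.prems obtain j where "j < length ps" "ps ! j = q" by (auto simp: in_set_conv_nth)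
    with js show ?case by (intro exI[of _ "j # js"]) auto
  qed simp
  then obtain js where js: "set js \<subseteq> {..<length ps}" "qs = map ((!) ps) js" by blast
  with qs show "pcp_solvable ps"
    unfolding pcp_solvable_def by (intro exI[of _ js]) (auto simp: comp_def)
qed

text \<open>\<open>Dollar\<close> will occur only in the start pair and \<open>Fin\<close> only in
  the end pair, so each of them identifies a position in a solution.\<close>

datatype 'b marked = Ch 'b | Hash | Dollar | Fin

definition before :: "'b list \<Rightarrow> 'b marked list" where
  "before xs = concat (map (\<lambda>x. [Hash, Ch x]) xs)"

definition after :: "'b list \<Rightarrow> 'b marked list" where
  "after xs = concat (map (\<lambda>x. [Ch x, Hash]) xs)"

lemma before_simps [simp]:
  "before [] = []" "before (x # xs) = Hash # Ch x # before xs" "before (xs @ ys) = before xs @ before ys"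
  by (simp_all add: before_def)

lemma after_simps [simp]:
  "after [] = []" "after (x # xs) = Ch x # Hash # after xs" "after (xs @ ys) = after xs @ after ys"
  by (simp_all add: after_def)

text \<open>The two spacings differ by a shift: one extra separator in front turns the form on the
  first side into the form on the second.\<close>

lemma Hash_after: "Hash # after xs @ zs = before xs @ Hash # zs"
  by (induction xs) auto

lemma after_Cons: "xs \<noteq> [] \<Longrightarrow> \<exists>x zs. after xs = Ch x # zs"
  by (cases xs) auto

lemma before_Cons: "xs \<noteq> [] \<Longrightarrow> \<exists>zs. before xs = Hash # zs"
  by (cases xs) auto

text \<open>Parity of positions: counted from 0, \<open>before ys\<close> has separators at even and
  letters at odd positions. If \<open>ys\<close> is at most as long as \<open>xs\<close>, then
  \<open>a\<close> falls on a separator; otherwise the second of the two adjacent separators falls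
  on a letter. The next two lemmas rest on the same parity.\<close>

lemma before_clash:
  "a \<noteq> Hash \<Longrightarrow> before xs @ Hash # Hash # zs = before ys @ a # zs' \<Longrightarrow> False"
proof (induction xs arbitrary: ys)
  case Nil then show ?case by (cases ys) auto
next
  case (Cons x xs) then show ?case by (cases ys) auto
qed

lemma before_clash_Dollar: "before xs @ Hash # Dollar # zs = before ys @ Dollar # zs' \<Longrightarrow> False"
proof (induction xs arbitrary: ys)
  case Nil then show ?case by (cases ys) auto
next
  case (Cons x xs) then show ?case by (cases ys) auto
qed

lemma before_clash_end: "before xs @ [Hash] = before ys \<Longrightarrow> False"
proof (induction xs arbitrary: ys)
  case Nil then show ?case by (cases ys) auto
next
  case (Cons x xs) then show ?case by (cases ys) auto
qed

lemma before_Fin_cancel: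
  "before xs @ Hash # Fin # zs = before ys @ Hash # Fin # zs' \<Longrightarrow> xs = ys"
proof (induction xs arbitrary: ys)
  case Nil then show ?case by (cases ys) auto
next
  case (Cons x xs) then show ?case by (cases ys) auto
qed

section \<open>Marked pairs and the symmetric closure\<close>

definition mark_pair :: "'b list \<times> 'b list \<Rightarrow> 'b marked list \<times> 'b marked list" where
  "mark_pair p = (after (fst p), before (snd p))"

definition start_pair :: "'b list \<Rightarrow> 'b list \<Rightarrow> 'b marked list \<times> 'b marked list" where
  "start_pair s t = (Dollar # Hash # after s, Dollar # before t)"

definition end_pair :: "'b list \<Rightarrow> 'b list \<Rightarrow> 'b marked list \<times> 'b marked list" where
  "end_pair e f = (after e @ [Fin], before f @ [Hash, Fin])"

lemma concat_mark_pair: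
  "concat (map fst (map mark_pair us)) = after (concat (map fst us))"
  "concat (map snd (map mark_pair us)) = before (concat (map snd us))"
  by (induction us) (auto simp: mark_pair_def)

text \<open>Splits off the longest initial run of unswapped ordinary pairs, so that only the first
  exceptional pair needs a case distinction.\<close>

lemma split_marked:
  "\<exists>us rest. qs = map mark_pair us @ rest \<and> set us \<subseteq> U \<and> (rest = [] \<or> hd rest \<notin> mark_pair ` U)"
proof (induction qs)
  case Nil
  then show ?case by (intro exI[of _ "[]"]) simp
next
  case (Cons q qs)
  then obtain us rest where IH: "qs = map mark_pair us @ rest" "set us \<subseteq> U"
    "rest = [] \<or> hd rest \<notin> mark_pair ` U"
    by blast
  show ?case
  proof (cases "q \<in> mark_pair ` U")
    case True
    then obtain u where "q = mark_pair u" "u \<in> U" by blast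
    with IH show ?thesis by (intro exI[of _ "u # us"] exI[of _ rest]) simp
  next
    case False
    then show ?thesis by (intro exI[of _ "[]"] exI[of _ "q # qs"]) simp
  qed
qed

lemma converse_eq_swap: "G\<inverse> = prod.swap ` G"
  by force

text \<open>
  In a solution of the symmetrised problem the orientation of the first pair persists: after unswapped
  pairs the two sides are \<open>before x @ [Hash]\<close> and \<open>before y\<close> (up to the initial \<open>Dollar\<close>), and a
  swapped pair would put \<open>Hash Hash\<close> on the first side and two letters in a row on the second.
\<close>

lemma oriented_solution:
  assumes ne: "\<And>u v. (u, v) \<in> U \<Longrightarrow> u \<noteq> [] \<and> v \<noteq> []"
    and qs: "set qs \<subseteq> insert (start_pair s t) (insert (end_pair e f) (mark_pair ` U))
               \<union> (insert (start_pair s t) (insert (end_pair e f) (mark_pair ` U)))\<inverse>"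
    and eq: "concat (map fst (start_pair s t # qs)) = concat (map snd (start_pair s t # qs))"
  shows "\<exists>us. set us \<subseteq> U \<and> s @ concat (map fst us) @ e = t @ concat (map snd us) @ f"
proof -
  obtain us rest where us: "qs = map mark_pair us @ rest" "set us \<subseteq> U"
    and rest: "rest = [] \<or> hd rest \<notin> mark_pair ` U"
    using split_marked by blast
  define x y where "x = s @ concat (map fst us)" and "y = t @ concat (map snd us)"
  have eq': "before x @ Hash # concat (map fst rest) = before y @ concat (map snd rest)"
    using eq by (simp add: us(1) start_pair_def concat_mark_pair x_def y_def Hash_after del: map_map)
  show ?thesis
  proof (cases rest)
    case Nil
    with eq' show ?thesis using before_clash_end by auto
  next
    case (Cons q rest')
    have q: "q \<in> insert (start_pair s t) (insert (end_pair e f) (mark_pair ` U))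
               \<union> (insert (start_pair s t) (insert (end_pair e f) (mark_pair ` U)))\<inverse>"
      "q \<notin> mark_pair ` U"
      using qs us(1) rest Cons by auto
    then consider "q = start_pair s t" | "q = prod.swap (start_pair s t)" | "q = end_pair e f"
      | "q = prod.swap (end_pair e f)" | p where "p \<in> U" "q = prod.swap (mark_pair p)"
      unfolding converse_eq_swap by blast
    then show ?thesis
    proof cases
      case 1
      with eq' Cons show ?thesis using before_clash_Dollar by (fastforce simp: start_pair_def)
    next
      case 2
      with eq' Cons show ?thesis using before_clash_Dollar by (fastforce simp: start_pair_def)
    next
      case 3
      with eq' Cons have "before (x @ e) @ Hash # Fin # concat (map fst rest')
          = before (y @ f) @ Hash # Fin # concat (map snd rest')"
        by (simp add: end_pair_def flip: Hash_after)
      \<comment> \<open>The first \<open>Fin\<close> on either side stands here, so whatever pairs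
        follow the end pair are irrelevant.\<close>
      then have "x @ e = y @ f" by (rule before_Fin_cancel)
      with us(2) show ?thesis by (auto simp: x_def y_def)
    next
      case 4
      obtain a zs where "after e @ [Fin] = a # zs" "a \<noteq> Hash"
        by (cases e) auto
      moreover obtain zs' where "before f @ [Hash, Fin] = Hash # zs'"
        by (cases f) auto
      ultimately have "before x @ Hash # Hash # zs' @ concat (map fst rest')
          = before y @ a # zs @ concat (map snd rest')"
        using eq' Cons 4 by (simp add: end_pair_def)
      with \<open>a \<noteq> Hash\<close> show ?thesis using before_clash by blast
    next
      case 5
      with ne[of "fst p" "snd p"] obtain c zs zs'
        where "after (fst p) = Ch c # zs" "before (snd p) = Hash # zs'"
        using after_Cons before_Cons by (metis prod.collapse)
      then have "before x @ Hash # Hash # zs' @ concat (map fst rest')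
          = before y @ Ch c # zs @ concat (map snd rest')"
        using eq' Cons 5 by (simp add: mark_pair_def)
      then show ?thesis using before_clash by blast
    qed
  qed
qed

text \<open>Every pair except the start pair begins with a separator on one side and with something
  else on the other, in both orientations. Hence a solution must open with the start pair or its
  swap, and in the latter case swapping all pairs gives a solution of the first kind. Nonempty sides
  in \<open>U\<close> are what makes the first letters differ.\<close>

lemma symmetric_solution_iff:
  fixes s t e f :: "'b list"
  assumes ne: "\<And>u v. (u, v) \<in> U \<Longrightarrow> u \<noteq> [] \<and> v \<noteq> []"
  defines "G \<equiv> insert (start_pair s t) (insert (end_pair e f) (mark_pair ` U))"
  shows "(\<exists>qs. qs \<noteq> [] \<and> set qs \<subseteq> G \<union> G\<inverse> \<and> concat (map fst qs) = concat (map snd qs)) \<longleftrightarrow>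
    (\<exists>us. set us \<subseteq> U \<and> s @ concat (map fst us) @ e = t @ concat (map snd us) @ f)"
proof
  assume "\<exists>qs. qs \<noteq> [] \<and> set qs \<subseteq> G \<union> G\<inverse> \<and> concat (map fst qs) = concat (map snd qs)"
  then obtain q qs where qs: "set (q # qs) \<subseteq> G \<union> G\<inverse>"
    "concat (map fst (q # qs)) = concat (map snd (q # qs))"
    by (metis neq_Nil_conv)
  have "q = start_pair s t \<or> q = prod.swap (start_pair s t)"
  proof (rule ccontr)
    assume "\<not> ?thesis"
    moreover have "q \<in> G \<union> G\<inverse>"
      using qs(1) by simp
    ultimately have "q \<in> insert (end_pair e f) (mark_pair ` U) \<union> (insert (end_pair e f) (mark_pair ` U))\<inverse>"
      unfolding G_def converse_eq_swap by blast
    then consider "q = end_pair e f" | "q = prod.swap (end_pair e f)"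
      | p where "p \<in> U" "q = mark_pair p"
      | p where "p \<in> U" "q = prod.swap (mark_pair p)"
      unfolding converse_eq_swap by blast
    then show False
    proof cases
      case 1
      with qs(2) show False by (cases e; cases f) (auto simp: end_pair_def)
    next
      case 2
      with qs(2) show False by (cases e; cases f) (auto simp: end_pair_def)
    next
      case 3
      obtain u v where "p = (u, v)" by fastforce
      with 3 qs(2) ne[of u v] show False by (cases u; cases v) (auto simp: mark_pair_def)
    next
      case 4
      obtain u v where "p = (u, v)" by fastforce
      with 4 qs(2) ne[of u v] show False by (cases u; cases v) (auto simp: mark_pair_def)
    qed
  qed
  then show "\<exists>us. set us \<subseteq> U \<and> s @ concat (map fst us) @ e = t @ concat (map snd us) @ f"
  proof
    assume "q = start_pair s t"
    with qs show ?thesis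
      by (intro oriented_solution[where qs = qs] ne) (auto simp: G_def)
  next
    assume q: "q = prod.swap (start_pair s t)"
    have "set (map prod.swap qs) \<subseteq> G \<union> G\<inverse>"
      using qs(1) by auto
    moreover have "concat (map fst (start_pair s t # map prod.swap qs))
        = concat (map snd (start_pair s t # map prod.swap qs))"
      using qs(2) by (simp add: q comp_def)
    ultimately show ?thesis
      by (intro oriented_solution[where qs = "map prod.swap qs"] ne) (auto simp: G_def)
  qed
next
  assume "\<exists>us. set us \<subseteq> U \<and> s @ concat (map fst us) @ e = t @ concat (map snd us) @ f"
  then obtain us where us: "set us \<subseteq> U" "s @ concat (map fst us) @ e = t @ concat (map snd us) @ f"
    by blast
  define qs where "qs = start_pair s t # map mark_pair us @ [end_pair e f]"
  have "concat (map fst qs) = Dollar # Hash # after (s @ concat (map fst us) @ e) @ [Fin]"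
    by (simp add: qs_def start_pair_def end_pair_def concat_mark_pair del: map_map)
  also have "\<dots> = Dollar # before (t @ concat (map snd us) @ f) @ [Hash, Fin]"
    by (simp only: us(2) Hash_after)
  also have "\<dots> = concat (map snd qs)"
    by (simp add: qs_def start_pair_def end_pair_def concat_mark_pair del: map_map)
  finally have "concat (map fst qs) = concat (map snd qs)" .
  moreover have "qs \<noteq> []" "set qs \<subseteq> G \<union> G\<inverse>"
    using us(1) by (auto simp: qs_def G_def)
  ultimately show "\<exists>qs. qs \<noteq> [] \<and> set qs \<subseteq> G \<union> G\<inverse> \<and> concat (map fst qs) = concat (map snd qs)"
    by blast
qed

section \<open>Rewriting as a correspondence problem\<close>

definition rewrite :: "('c list \<times> 'c list) set \<Rightarrow> 'c list \<Rightarrow> 'c list \<Rightarrow> bool" where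
  "rewrite R x y \<longleftrightarrow> (\<exists>a b l r. (l, r) \<in> R \<and> x = a @ l @ b \<and> y = a @ r @ b)"

text \<open>The letter \<open>None\<close> separates the words of a derivation.\<close>

definition rewrite_pairs :: "('c list \<times> 'c list) set \<Rightarrow> ('c option list \<times> 'c option list) set" where
  "rewrite_pairs R = map_prod (map Some) (map Some) ` R \<union> range (\<lambda>c. ([c], [c]))"

text \<open>A word without \<open>None\<close> cannot reach past the first separator.\<close>

lemma map_Some_prefix:
  "map Some l @ z = map Some x @ None # w \<Longrightarrow> \<exists>x'. x = l @ x' \<and> z = map Some x' @ None # w"
proof (induction l arbitrary: x)
  case (Cons c l)
  then show ?case by (cases x) auto
qed simp

text \<open>Invariant: the second side is ahead by the unread rest \<open>x\<close> of the current
  word and the part \<open>y\<close> of the next word written so far, which together represent the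
  word \<open>y @ x\<close>. A rule pair rewrites it, a copying pair leaves it unchanged, and the
  separator pair, possible only for empty \<open>x\<close>, starts the next pass.\<close>

lemma pairs_imp_rewrites:
  assumes "set us \<subseteq> rewrite_pairs R"
    and "concat (map fst us) @ map Some z @ [None]
      = map Some x @ None # map Some y @ concat (map snd us)"
  shows "(rewrite R)\<^sup>*\<^sup>* (y @ x) z"
  using assms
proof (induction us arbitrary: x y)
  case Nil
  then obtain x' where "x = z @ x'" "[None] = map Some x' @ None # map Some y"
    using map_Some_prefix[of z "[None]" x "map Some y"] by auto
  then show ?case by (cases x') auto
next
  case (Cons p us)
  from Cons.prems(1) consider l r where "(l, r) \<in> R" "p = (map Some l, map Some r)"
    | c where "p = ([Some c], [Some c])" | "p = ([None], [None])"
    unfolding rewrite_pairs_def by (auto; metis option.exhaust)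
  then show ?case
  proof cases
    case 1
    with Cons.prems(2) have "map Some l @ (concat (map fst us) @ map Some z @ [None])
        = map Some x @ None # map Some y @ map Some r @ concat (map snd us)"
      by simp
    from map_Some_prefix[OF this] obtain x' where x': "x = l @ x'"
      "concat (map fst us) @ map Some z @ [None] = map Some x' @ None # map Some (y @ r) @ concat (map snd us)"
      by auto
    then have "(rewrite R)\<^sup>*\<^sup>* ((y @ r) @ x') z"
      using Cons.prems(1) by (intro Cons.IH) auto
    moreover have "rewrite R (y @ x) ((y @ r) @ x')"
      unfolding rewrite_def using 1(1) x'(1) by auto
    ultimately show ?thesis by (rule converse_rtranclp_into_rtranclp[rotated])
  next
    case 2
    with Cons.prems(2) have "map Some [c] @ (concat (map fst us) @ map Some z @ [None])
        = map Some x @ None # map Some y @ map Some [c] @ concat (map snd us)"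
      by simp
    from map_Some_prefix[OF this] obtain x' where x': "x = [c] @ x'"
      "concat (map fst us) @ map Some z @ [None] = map Some x' @ None # map Some (y @ [c]) @ concat (map snd us)"
      by auto
    then have "(rewrite R)\<^sup>*\<^sup>* ((y @ [c]) @ x') z"
      using Cons.prems(1) by (intro Cons.IH) auto
    with x'(1) show ?thesis by simp
  next
    case 3
    with Cons.prems(2) have "x = []" by (cases x) auto
    with 3 Cons.prems have "(rewrite R)\<^sup>*\<^sup>* ([] @ y) z"
      by (intro Cons.IH) auto
    with \<open>x = []\<close> show ?thesis by simp
  qed
qed

lemma rewrites_imp_pairs:
  assumes "(rewrite R)\<^sup>*\<^sup>* w z"
  shows "\<exists>us. set us \<subseteq> rewrite_pairs R \<and>
    concat (map fst us) @ map Some z @ [None] = map Some w @ None # concat (map snd us)"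
  using assms
proof (induction rule: converse_rtranclp_induct)
  case base
  then show ?case by (intro exI[of _ "[]"]) simp
next
  case (step w w')
  then obtain us a b l r where us: "set us \<subseteq> rewrite_pairs R"
    "concat (map fst us) @ map Some z @ [None] = map Some w' @ None # concat (map snd us)"
    and r: "(l, r) \<in> R" "w = a @ l @ b" "w' = a @ r @ b"
    unfolding rewrite_def by blast
  define copy where "copy = map (\<lambda>c::'a option. ([c], [c]))"
  have copy: "set (copy xs) \<subseteq> rewrite_pairs R" "concat (map fst (copy xs)) = xs"
    "concat (map snd (copy xs)) = xs" for xs
    by (induction xs) (auto simp: copy_def rewrite_pairs_def)
  have lr: "(map Some l, map Some r) \<in> rewrite_pairs R"
    using r(1) by (force simp: rewrite_pairs_def)
  \<comment> \<open>A single derivation step becomes a full pass over the word: copy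
    \<open>a\<close>, apply the rule, copy \<open>b\<close> and the separator.\<close>
  show ?case
    by (rule exI[of _ "copy (map Some a) @ (map Some l, map Some r) # copy (map Some b @ [None]) @ us"])
      (use us copy lr r in \<open>simp\<close>)
qed

text \<open>The empty words bring the statement into the shape with prescribed first and last pair:
  the second side starts one word ahead, and the first side catches up at the end.\<close>

lemma rewrites_iff_pairs:
  "(rewrite R)\<^sup>*\<^sup>* w z \<longleftrightarrow> (\<exists>us. set us \<subseteq> rewrite_pairs R \<and>
    [] @ concat (map fst us) @ map Some z @ [None] = (map Some w @ [None]) @ concat (map snd us) @ [])"
  using rewrites_imp_pairs[of R w z] pairs_imp_rewrites[of _ R z w "[]"] by auto

section \<open>Binary block codes\<close>

text \<open>A unary prefix code: two letters suffice for any number of source letters, since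
  \<open>b\<close> occurs only as the end of a block.\<close>

definition block_code :: "'a \<Rightarrow> 'a \<Rightarrow> ('b \<Rightarrow> nat) \<Rightarrow> 'b list \<Rightarrow> 'a list" where
  "block_code a b g xs = concat (map (\<lambda>x. replicate (g x) a @ [b]) xs)"

lemma block_code_append [simp]:
  "block_code a b g (xs @ ys) = block_code a b g xs @ block_code a b g ys"
  by (simp add: block_code_def)

lemma block_code_in_lists: "a \<in> A \<Longrightarrow> b \<in> A \<Longrightarrow> block_code a b g xs \<in> lists A"
  by (auto simp: block_code_def split: if_splits)

lemma replicate_stop_eq:
  "a \<noteq> b \<Longrightarrow> replicate m a @ b # xs = replicate n a @ b # ys \<Longrightarrow> m = n \<and> xs = ys"
proof (induction m arbitrary: n)
  case 0 then show ?case by (cases n) auto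
next
  case (Suc m) then show ?case by (cases n) auto
qed

lemma inj_block_code:
  assumes "a \<noteq> b" "inj g"
  shows "inj (block_code a b g)"
proof (rule injI)
  fix xs ys assume "block_code a b g xs = block_code a b g ys"
  then show "xs = ys"
  proof (induction xs arbitrary: ys)
    case Nil
    then show ?case by (cases ys) (auto simp: block_code_def)
  next
    case (Cons x xs)
    then obtain y ys' where ys: "ys = y # ys'" by (cases ys) (auto simp: block_code_def)
    with Cons.prems have "replicate (g x) a @ b # block_code a b g xs
        = replicate (g y) a @ b # block_code a b g ys'"
      by (simp add: block_code_def)
    from replicate_stop_eq[OF assms(1) this] show ?case
      using Cons.IH[of ys'] \<open>inj g\<close> ys by (auto dest: injD)
  qed
qed

section \<open>A structured counter language\<close>

text \<open>Loops instead of jumps: the interpreter then has no labels to look up and only has to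
  match brackets, which a fixed set of rules can do.\<close>

datatype instr = Inc | Dec | Lt | Rt | Loop "instr list"

inductive exec :: "instr list \<Rightarrow> nat \<Rightarrow> (nat \<Rightarrow> nat) \<Rightarrow> nat \<Rightarrow> (nat \<Rightarrow> nat) \<Rightarrow> bool" where
  exec_Nil: "exec [] p t p t"
| exec_Inc: "exec P p (t(p := Suc (t p))) p' t' \<Longrightarrow> exec (Inc # P) p t p' t'"
| exec_Dec: "exec P p (t(p := t p - 1)) p' t' \<Longrightarrow> exec (Dec # P) p t p' t'"
| exec_Lt: "exec P p t p' t' \<Longrightarrow> exec (Lt # P) (Suc p) t p' t'"
| exec_Rt: "exec P (Suc p) t p' t' \<Longrightarrow> exec (Rt # P) p t p' t'"
| exec_Loop_0: "t p = 0 \<Longrightarrow> exec P p t p' t' \<Longrightarrow> exec (Loop B # P) p t p' t'"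
| exec_Loop_Suc: "t p > 0 \<Longrightarrow> exec B p t p1 t1 \<Longrightarrow> exec (Loop B # P) p1 t1 p' t'
    \<Longrightarrow> exec (Loop B # P) p t p' t'"

lemma exec_append [trans]:
  "exec P p t p1 t1 \<Longrightarrow> exec Q p1 t1 p' t' \<Longrightarrow> exec (P @ Q) p t p' t'"
  by (induction rule: exec.induct) (auto intro: exec.intros)

lemmas exec_single = exec_Inc[OF exec_Nil] exec_Dec[OF exec_Nil] exec_Lt[OF exec_Nil]
  exec_Rt[OF exec_Nil]

lemma exec_lefts: "d \<le> p \<Longrightarrow> exec (replicate d Lt) p t (p - d) t"
proof (induction d arbitrary: p)
  case (Suc d)
  then obtain p' where "p = Suc p'" by (cases p) auto
  with Suc show ?case by (auto intro: exec_Lt)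
qed (auto intro: exec_Nil)

lemma exec_rights: "exec (replicate d Rt) p t (p + d) t"
proof (induction d arbitrary: p)
  case (Suc d)
  from Suc[of "Suc p"] show ?case by (auto intro: exec_Rt)
qed (auto intro: exec_Nil)

lemma exec_clear: "exec [Loop [Dec]] p t p (t(p := 0))"
proof (induction "t p" arbitrary: t)
  case 0
  then have "t(p := 0) = t" by auto
  with 0 show ?case by (auto intro: exec_Loop_0 exec_Nil)
next
  case (Suc n)
  have "exec [Loop [Dec]] p (t(p := t p - 1)) p (t(p := t p - 1, p := 0))"
    using Suc(2) by (intro Suc(1)) auto
  moreover have "0 < t p" using Suc(2) by simp
  ultimately show ?case using exec_Loop_Suc[OF _ exec_single(2)] by simp
qed

definition transfer :: "nat \<Rightarrow> instr list" where
  "transfer d = [Loop (Dec # replicate d Lt @ Inc # replicate d Rt)]"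

lemma exec_transfer:
  assumes "0 < d" "d \<le> p"
  shows "exec (transfer d) p t p (t(p := 0, p - d := t (p - d) + t p))"
proof (induction "t p" arbitrary: t)
  case 0
  then have t: "t(p := 0, p - d := t (p - d) + t p) = t" by auto
  have "exec (transfer d) p t p t"
    unfolding transfer_def using 0 by (intro exec_Loop_0 exec_Nil) simp
  then show ?case unfolding t .
next
  case (Suc n)
  define t1 where "t1 = t(p := t p - 1)"
  define t2 where "t2 = t1(p - d := Suc (t1 (p - d)))"
  have "exec [Dec] p t p t1"
    unfolding t1_def by (rule exec_single)
  also have "exec (replicate d Lt) p t1 (p - d) t1"
    using assms by (intro exec_lefts)
  also have "exec [Inc] (p - d) t1 (p - d) t2"
    unfolding t2_def by (rule exec_single)
  also have "exec (replicate d Rt) (p - d) t2 (p - d + d) t2"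
    by (rule exec_rights)
  finally have body: "exec (Dec # replicate d Lt @ Inc # replicate d Rt) p t p t2"
    using assms by simp
  have "exec (transfer d) p t2 p (t2(p := 0, p - d := t2 (p - d) + t2 p))"
    using Suc(2) assms by (intro Suc(1)) (auto simp: t1_def t2_def)
  moreover have "t2(p := 0, p - d := t2 (p - d) + t2 p) = t(p := 0, p - d := t (p - d) + t p)"
    using Suc(2) assms by (auto simp: t1_def t2_def)
  moreover have "0 < t p" using Suc(2) by simp
  ultimately show ?case
    using exec_Loop_Suc[OF _ body] unfolding transfer_def by simp
qed

definition spread :: "nat \<Rightarrow> instr list" where
  "spread d = [Loop (Dec # replicate d Rt @ Inc # Rt # Inc # replicate (Suc d) Lt)]"

lemma exec_spread:
  assumes "0 < d"
  shows "exec (spread d) p t p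
    (t(p := 0, p + d := t (p + d) + t p, p + Suc d := t (p + Suc d) + t p))"
proof (induction "t p" arbitrary: t)
  case 0
  then have t: "t(p := 0, p + d := t (p + d) + t p, p + Suc d := t (p + Suc d) + t p) = t" by auto
  have "exec (spread d) p t p t"
    unfolding spread_def using 0 by (intro exec_Loop_0 exec_Nil) simp
  then show ?case unfolding t .
next
  case (Suc n)
  define t1 where "t1 = t(p := t p - 1)"
  define t2 where "t2 = t1(p + d := Suc (t1 (p + d)))"
  define t3 where "t3 = t2(p + Suc d := Suc (t2 (p + Suc d)))"
  have "exec [Dec] p t p t1"
    unfolding t1_def by (rule exec_single)
  also have "exec (replicate d Rt) p t1 (p + d) t1"
    by (rule exec_rights)
  also have "exec [Inc] (p + d) t1 (p + d) t2"
    unfolding t2_def by (rule exec_single)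
  also have "exec [Rt] (p + d) t2 (Suc (p + d)) t2"
    by (rule exec_single)
  also have "exec [Inc] (Suc (p + d)) t2 (Suc (p + d)) t3"
    unfolding t3_def using exec_single(1)[of "Suc (p + d)" t2] by simp
  also have "exec (replicate (Suc d) Lt) (Suc (p + d)) t3 (Suc (p + d) - Suc d) t3"
    by (rule exec_lefts) simp
  finally have body: "exec (Dec # replicate d Rt @ Inc # Rt # Inc # replicate (Suc d) Lt) p t p t3"
    by simp
  have "exec (spread d) p t3 p
      (t3(p := 0, p + d := t3 (p + d) + t3 p, p + Suc d := t3 (p + Suc d) + t3 p))"
    using Suc(2) assms by (intro Suc(1)) (auto simp: t1_def t2_def t3_def)
  moreover have "t3(p := 0, p + d := t3 (p + d) + t3 p, p + Suc d := t3 (p + Suc d) + t3 p)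
      = t(p := 0, p + d := t (p + d) + t p, p + Suc d := t (p + Suc d) + t p)"
    using Suc(2) assms by (auto simp: t1_def t2_def t3_def)
  moreover have "0 < t p" using Suc(2) by simp
  ultimately show ?case
    using exec_Loop_Suc[OF _ body] unfolding spread_def by simp
qed

text \<open>A counter can be read only by emptying it. The value is therefore poured into two cells,
  the target and its right neighbour, and the second copy is carried back to the source.\<close>

definition copy_from :: "nat \<Rightarrow> instr list" where
  "copy_from d = replicate d Lt @ spread d @ replicate (Suc d) Rt @ transfer (Suc d) @ [Lt]"

lemma exec_copy_from:
  assumes "0 < d" "d \<le> q" "t q = 0" "t (Suc q) = 0"
  shows "exec (copy_from d) q t q (t(q := t (q - d)))"
proof -
  define p where "p = q - d"
  have q: "q = p + d" using assms(2) by (simp add: p_def)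
  define t1 where "t1 = t(p := 0, p + d := t (p + d) + t p, p + Suc d := t (p + Suc d) + t p)"
  have "exec (replicate d Lt) q t p t"
    unfolding p_def using assms by (intro exec_lefts)
  also have "exec (spread d) p t p t1"
    unfolding t1_def using assms(1) by (rule exec_spread)
  also have "exec (replicate (Suc d) Rt) p t1 (p + Suc d) t1"
    by (rule exec_rights)
  also have "exec (transfer (Suc d)) (p + Suc d) t1 (Suc q) (t(q := t (q - d)))"
  proof -
    have "t1(p + Suc d := 0, p + Suc d - Suc d := t1 (p + Suc d - Suc d) + t1 (p + Suc d))
        = t(q := t (q - d))"
      using assms by (auto simp: t1_def q)
    then show ?thesis
      using exec_transfer[of "Suc d" "p + Suc d" t1] by (simp add: q)
  qed
  also have "exec [Lt] (Suc q) (t(q := t (q - d))) q (t(q := t (q - d)))"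
    by (rule exec_single)
  finally show ?thesis by (simp add: copy_from_def)
qed

section \<open>Compiling recursive functions\<close>

text \<open>After each stored result the pointer moves one cell to the right, so all distances grow
  by one.\<close>

primrec compile_args :: "(nat list \<Rightarrow> instr list) list \<Rightarrow> nat list \<Rightarrow> instr list" where
  "compile_args [] ds = []"
| "compile_args (c # cs) ds = c ds @ Rt # compile_args cs (map Suc ds)"

text \<open>
  In \<open>compile f ds\<close> the entry \<open>ds ! i\<close> is the distance by which the \<open>i\<close>-th argument lies to the left
  of the pointer; the result is stored at the pointer, and all cells from there on must be \<open>0\<close> initially.
\<close>

primrec compile :: "recf \<Rightarrow> nat list \<Rightarrow> instr list" where
  "compile Zero = (\<lambda>ds. [])"
| "compile Succ = (\<lambda>ds. copy_from (hd ds) @ [Inc])"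
| "compile (Proj i) = (\<lambda>ds. copy_from (ds ! i))"
| "compile (Comp f gs) = (\<lambda>ds. Rt # compile_args (map compile gs) (map Suc ds)
     @ compile f (rev [1..<Suc (length gs)])
     @ concat (replicate (length gs) [Lt, Loop [Dec]])
     @ replicate (length gs) Rt @ transfer (Suc (length gs)) @ replicate (Suc (length gs)) Lt)"
| "compile (PrimRec f g) = (\<lambda>ds. compile f (tl ds) @ Rt # copy_from (Suc (hd ds))
     @ Loop (Dec # Rt # Rt # compile g (1 # 3 # map ((+) 3) (tl ds))
         @ replicate 3 Lt @ Loop [Dec] # replicate 3 Rt @ transfer 3 @ [Lt, Inc, Lt])
     # [Rt, Loop [Dec], Lt, Lt])"
| "compile (Mu f) = (\<lambda>ds. Rt # compile f (1 # map Suc ds)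
     @ [Loop (Loop [Dec] # Lt # Inc # Rt # compile f (1 # map Suc ds)), Lt])"

text \<open>The condition \<open>0 < d\<close> keeps the arguments strictly left of the pointer, so
  that storing the result cannot overwrite one of them.\<close>

definition env :: "nat \<Rightarrow> (nat \<Rightarrow> nat) \<Rightarrow> nat list \<Rightarrow> nat list \<Rightarrow> bool" where
  "env q t ds xs \<longleftrightarrow> list_all2 (\<lambda>d x. 0 < d \<and> d \<le> q \<and> t (q - d) = x) ds xs"

lemma env_shift:
  "env q t ds xs \<Longrightarrow> (\<And>i. i < q \<Longrightarrow> t' i = t i) \<Longrightarrow> env (q + k) t' (map ((+) k) ds) xs"
  unfolding env_def list_all2_conv_all_nth by auto

lemma env_shift_Suc:
  "env q t ds xs \<Longrightarrow> (\<And>i. i < q \<Longrightarrow> t' i = t i) \<Longrightarrow> env (Suc q) t' (map Suc ds) xs"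
  unfolding env_def list_all2_conv_all_nth by auto

lemma env_Cons [simp]:
  "env q t (d # ds) (x # xs) \<longleftrightarrow> 0 < d \<and> d \<le> q \<and> t (q - d) = x \<and> env q t ds xs"
  by (simp add: env_def)

text \<open>The conclusion fixes the whole tape: all scratch cells are 0 again and the arguments are
  intact. This is what allows compiled code to be run repeatedly inside loops.\<close>

definition compiled :: "recf \<Rightarrow> bool" where
  "compiled f \<longleftrightarrow> (\<forall>xs y ds q t. computes f xs y \<longrightarrow> env q t ds xs \<longrightarrow> (\<forall>i\<ge>q. t i = 0) \<longrightarrow>
     exec (compile f ds) q t q (t(q := y)))"

lemma compiledD:
  "compiled f \<Longrightarrow> computes f xs y \<Longrightarrow> env q t ds xs \<Longrightarrow> (\<And>i. i \<ge> q \<Longrightarrow> t i = 0) \<Longrightarrow>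
     exec (compile f ds) q t q (t(q := y))"
  unfolding compiled_def by blast

primrec store :: "(nat \<Rightarrow> nat) \<Rightarrow> nat \<Rightarrow> nat list \<Rightarrow> nat \<Rightarrow> nat" where
  "store t q [] = t"
| "store t q (y # ys) = store (t(q := y)) (Suc q) ys"

lemma store_eq: "store t q ys i = (if q \<le> i \<and> i < q + length ys then ys ! (i - q) else t i)"
  by (induction ys arbitrary: t q) (auto simp: nth_Cons' Suc_diff_le not_less_eq_eq)

lemma exec_compile_args:
  assumes "\<And>g. g \<in> set gs \<Longrightarrow> compiled g" "list_all2 (\<lambda>g. computes g xs) gs ys"
    "env q t ds xs" "\<And>i. i \<ge> q \<Longrightarrow> t i = 0"
  shows "exec (compile_args (map compile gs) ds) q t (q + length gs) (store t q ys)"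
  using assms
proof (induction gs arbitrary: ys q t ds)
  case Nil
  then show ?case by (auto intro: exec_Nil)
next
  case (Cons g gs)
  then obtain y ys' where ys: "ys = y # ys'" "computes g xs y" "list_all2 (\<lambda>g. computes g xs) gs ys'"
    by (auto simp: list_all2_Cons1)
  have "exec (compile g ds) q t q (t(q := y))"
    using Cons.prems ys by (intro compiledD) auto
  also have "exec [Rt] q (t(q := y)) (Suc q) (t(q := y))"
    by (rule exec_single)
  also have "exec (compile_args (map compile gs) (map Suc ds)) (Suc q) (t(q := y))
      (Suc q + length gs) (store (t(q := y)) (Suc q) ys')"
    using Cons.prems ys by (intro Cons.IH) (auto intro: env_shift_Suc)
  finally show ?case by (simp add: ys(1))
qed

lemma exec_clear_block:
  "m \<le> q \<Longrightarrow> exec (concat (replicate m [Lt, Loop [Dec]])) q t (q - m)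
     (\<lambda>i. if q - m \<le> i \<and> i < q then 0 else t i)"
proof (induction m arbitrary: q t)
  case 0
  then have "(\<lambda>i. if q - 0 \<le> i \<and> i < q then 0 else t i) = t" by auto
  then show ?case by (simp add: exec_Nil)
next
  case (Suc m)
  then obtain p where p: "q = Suc p" by (cases q) auto
  have "exec [Lt] q t p t"
    unfolding p by (rule exec_single)
  also have "exec [Loop [Dec]] p t p (t(p := 0))"
    by (rule exec_clear)
  also have "exec (concat (replicate m [Lt, Loop [Dec]])) p (t(p := 0)) (p - m)
     (\<lambda>i. if p - m \<le> i \<and> i < p then 0 else (t(p := 0)) i)"
    using Suc.prems p by (intro Suc.IH) simp
  also have "(\<lambda>i. if p - m \<le> i \<and> i < p then 0 else (t(p := 0)) i)
      = (\<lambda>i. if q - Suc m \<le> i \<and> i < q then 0 else t i)"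
    using Suc.prems p by (auto simp: fun_eq_iff)
  finally show ?case using p by simp
qed

text \<open>Layout: the values of \<open>gs\<close> occupy the \<open>m\<close> cells after
  \<open>q\<close>, and \<open>f\<close> is evaluated in the cell \<open>q1\<close> behind them.
  After these cells are cleared the value is moved to \<open>q\<close>, which is
  \<open>Suc m\<close> cells away. Seen from \<open>q1\<close> the first value is the farthest,
  hence the reversed list of distances.\<close>

lemma compiled_Comp:
  assumes f: "compiled f" and gs: "\<And>g. g \<in> set gs \<Longrightarrow> compiled g"
  shows "compiled (Comp f gs)"
  unfolding compiled_def
proof (intro allI impI)
  fix xs z ds q t
  assume c: "computes (Comp f gs) xs z" and env: "env q t ds xs" and t: "\<forall>i\<ge>q. t i = 0"
  from c obtain ys where ys: "list_all2 (\<lambda>g. computes g xs) gs ys" "computes f ys z"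
    by cases auto
  define m where "m = length gs"
  have len: "length ys = m"
    using ys(1) by (simp add: m_def list_all2_lengthD)
  define t1 where "t1 = store t (Suc q) ys"
  define q1 where "q1 = Suc q + m"
  have t1_0: "t1 i = 0" if "i \<ge> q1" for i
    using that t len by (simp add: t1_def store_eq q1_def)
  have t1_nth: "t1 (Suc (q + j)) = ys ! j" if "j < m" for j
    using that len by (simp add: t1_def store_eq)
  define t2 where "t2 = t1(q1 := z)"
  define t3 where "t3 = (\<lambda>i. if Suc q \<le> i \<and> i < q1 then 0 else t2 i)"
  have t3_q: "t3 q = 0" "t3 q1 = z"
    using t len by (auto simp: t3_def t2_def t1_def store_eq q1_def)
  have t3: "t3(q1 := 0, q := z) = t(q := z)"
    using t len by (auto simp: t3_def t2_def t1_def store_eq q1_def fun_eq_iff)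
  have "exec [Rt] q t (Suc q) t"
    by (rule exec_single)
  also have "exec (compile_args (map compile gs) (map Suc ds)) (Suc q) t q1 t1"
    unfolding q1_def t1_def m_def using gs ys(1) env t
    by (intro exec_compile_args env_shift_Suc) auto
  also have "exec (compile f (rev [1..<Suc m])) q1 t1 q1 t2"
    unfolding t2_def
  proof (rule compiledD[OF f ys(2)])
    show "env q1 t1 (rev [1..<Suc m]) ys"
      unfolding env_def list_all2_conv_all_nth
    proof (intro conjI allI impI)
      fix i assume "i < length (rev [1..<Suc m])"
      then have i: "i < m" by (simp del: upt_Suc)
      then have "rev [1..<Suc m] ! i = m - i"
        by (simp add: rev_nth del: upt_Suc)
      with i t1_nth[OF i] show "0 < rev [1..<Suc m] ! i" "rev [1..<Suc m] ! i \<le> q1"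
        "t1 (q1 - rev [1..<Suc m] ! i) = ys ! i"
        by (simp_all add: q1_def)
    qed (simp add: len)
  qed (rule t1_0)
  also have "exec (concat (replicate m [Lt, Loop [Dec]])) q1 t2 (Suc q) t3"
    using exec_clear_block[of m q1 t2] by (simp add: q1_def t3_def)
  also have "exec (replicate m Rt) (Suc q) t3 q1 t3"
    unfolding q1_def by (rule exec_rights)
  also have "exec (transfer (Suc m)) q1 t3 q1 (t(q := z))"
    using exec_transfer[of "Suc m" q1 t3] t3 t3_q by (simp add: q1_def)
  also have "exec (replicate (Suc m) Lt) q1 (t(q := z)) q (t(q := z))"
    using exec_lefts[of "Suc m" q1 "t(q := z)"] by (simp add: q1_def)
  finally show "exec (compile (Comp f gs) ds) q t q (t(q := z))"
    by (simp add: m_def)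
qed

text \<open>Unrolls the recursion into the sequence \<open>v\<close> of intermediate values, which
  serves as the loop invariant below.\<close>

lemma computes_PrimRecD:
  assumes "computes (PrimRec f g) (n # xs) y"
  shows "\<exists>v. computes f xs (v 0) \<and> (\<forall>i<n. computes g (i # v i # xs) (v (Suc i))) \<and> v n = y"
  using assms
proof (induction n arbitrary: y)
  case 0
  then have "computes f xs y" by cases auto
  then show ?case by (intro exI[of _ "\<lambda>_. y"]) simp
next
  case (Suc n)
  from Suc.prems obtain w where w: "computes (PrimRec f g) (n # xs) w" "computes g (n # w # xs) y"
    by cases auto
  from Suc.IH[OF w(1)] obtain v where v: "computes f xs (v 0)"
    "\<forall>i<n. computes g (i # v i # xs) (v (Suc i))" "v n = w"
    by blast
  with w(2) show ?case
    by (intro exI[of _ "v(Suc n := y)"]) (auto simp: less_Suc_eq)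
qed

lemma compiled_PrimRec:
  assumes f: "compiled f" and g: "compiled g"
  shows "compiled (PrimRec f g)"
  unfolding compiled_def
proof (intro allI impI)
  fix zs y ds q t
  assume c: "computes (PrimRec f g) zs y" and env: "env q t ds zs" and t: "\<forall>i\<ge>q. t i = 0"
  from c obtain n xs where zs: "zs = n # xs"
    by cases auto
  with env obtain d ds' where ds: "ds = d # ds'"
    by (cases ds) (auto simp: env_def)
  obtain v where v: "computes f xs (v 0)" "\<And>i. i < n \<Longrightarrow> computes g (i # v i # xs) (v (Suc i))" "v n = y"
    using computes_PrimRecD c zs by blast
  have d: "0 < d" "d \<le> q" "t (q - d) = n" and env': "env q t ds' xs"
    using env by (auto simp: zs ds)
  define B where "B = Dec # Rt # Rt # compile g (1 # 3 # map ((+) 3) ds')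
         @ replicate 3 Lt @ Loop [Dec] # replicate 3 Rt @ transfer 3 @ [Lt, Inc, Lt]"
  \<comment> \<open>State between two rounds: accumulator at \<open>q\<close>, remaining rounds at
    \<open>q + 1\<close>, index at \<open>q + 2\<close>. The new value is built at
    \<open>q + 3\<close>, because \<open>g\<close> still needs the old accumulator. From there index
    and accumulator lie at distances 1 and 3.\<close>
  define T where "T i = t(q := v i, q + 1 := n - i, q + 2 := i)" for i
  have body: "exec B (q + 1) (T i) (q + 1) (T (Suc i))" if i: "i < n" for i
  proof -
    define t1 where "t1 = (T i)(q + 1 := n - Suc i)"
    define t2 where "t2 = t1(q + 3 := v (Suc i))"
    define t3 where "t3 = t2(q := 0)"
    define t4 where "t4 = t3(q + 3 := 0, q := v (Suc i))"
    have "exec [Dec] (q + 1) (T i) (q + 1) t1"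
      using exec_single(2)[of "q + 1" "T i"] by (simp add: t1_def T_def)
    also have "exec [Rt] (q + 1) t1 (q + 2) t1"
      using exec_single(4)[of "q + 1" t1] by simp
    also have "exec [Rt] (q + 2) t1 (q + 3) t1"
      using exec_single(4)[of "q + 2" t1] by (simp add: eval_nat_numeral)
    also have "exec (compile g (1 # 3 # map ((+) 3) ds')) (q + 3) t1 (q + 3) t2"
      unfolding t2_def
    proof (rule compiledD[OF g v(2)[OF i]])
      have "env (q + 3) t1 (map ((+) 3) ds') xs"
        using env' by (rule env_shift) (simp add: t1_def T_def)
      then show "env (q + 3) t1 (1 # 3 # map ((+) 3) ds') (i # v i # xs)"
        by (simp add: t1_def T_def)
    qed (use t in \<open>simp add: t1_def T_def\<close>)
    also have "exec (replicate 3 Lt) (q + 3) t2 q t2"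
      using exec_lefts[of 3 "q + 3" t2] by simp
    also have "exec [Loop [Dec]] q t2 q t3"
      unfolding t3_def by (rule exec_clear)
    also have "exec (replicate 3 Rt) q t3 (q + 3) t3"
      by (rule exec_rights)
    also have "exec (transfer 3) (q + 3) t3 (q + 3) t4"
      using exec_transfer[of 3 "q + 3" t3] by (simp add: t4_def t3_def t2_def)
    also have "exec [Lt] (q + 3) t4 (q + 2) t4"
      using exec_single(3)[of "q + 2" t4] by (simp add: eval_nat_numeral)
    also have "exec [Inc] (q + 2) t4 (q + 2) (T (Suc i))"
    proof -
      have "t4(q + 2 := Suc (t4 (q + 2))) = T (Suc i)"
        using t by (auto simp: t4_def t3_def t2_def t1_def T_def fun_eq_iff)
      then show ?thesis using exec_single(1)[of "q + 2" t4] by simp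
    qed
    also have "exec [Lt] (q + 2) (T (Suc i)) (q + 1) (T (Suc i))"
      using exec_single(3)[of "q + 1" "T (Suc i)"] by simp
    finally show ?thesis by (simp add: B_def)
  qed
  have loop: "exec [Loop B] (q + 1) (T i) (q + 1) (T n)" if "i \<le> n" for i
    using that
  proof (induction rule: inc_induct)
    case base
    then show ?case by (intro exec_Loop_0 exec_Nil) (simp add: T_def)
  next
    case (step i)
    then have "0 < T i (q + 1)" by (simp add: T_def)
    from exec_Loop_Suc[OF this body step.IH] step.hyps show ?case by simp
  qed
  define t1 where "t1 = t(q := v 0)"
  have "exec (compile f ds') q t q t1"
    unfolding t1_def using t by (intro compiledD[OF f v(1) env']) auto
  also have "exec [Rt] q t1 (q + 1) t1"
    using exec_single(4)[of q t1] by simp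
  also have "exec (copy_from (Suc d)) (q + 1) t1 (q + 1) (T 0)"
  proof -
    have "t1(q + 1 := t1 (q + 1 - Suc d)) = T 0"
      using t d by (auto simp: t1_def T_def fun_eq_iff)
    then show ?thesis
      using exec_copy_from[of "Suc d" "q + 1" t1] d t by (simp add: t1_def)
  qed
  also have "exec [Loop B] (q + 1) (T 0) (q + 1) (T n)"
    by (rule loop) simp
  also have "exec [Rt] (q + 1) (T n) (q + 2) (T n)"
    using exec_single(4)[of "q + 1" "T n"] by simp
  also have "exec [Loop [Dec]] (q + 2) (T n) (q + 2) (t(q := y))"
  proof -
    have "(T n)(q + 2 := 0) = t(q := y)"
      using t v(3) by (auto simp: T_def fun_eq_iff)
    then show ?thesis using exec_clear[of "q + 2" "T n"] by simp
  qed
  also have "exec [Lt] (q + 2) (t(q := y)) (q + 1) (t(q := y))"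
    using exec_single(3)[of "q + 1"] by simp
  also have "exec [Lt] (q + 1) (t(q := y)) q (t(q := y))"
    using exec_single(3)[of q] by simp
  finally show "exec (compile (PrimRec f g) ds) q t q (t(q := y))"
    by (simp add: ds B_def)
qed

text \<open>The loop counts candidates up in cell \<open>q\<close> and keeps the value of
  \<open>f\<close> at the candidate in \<open>q + 1\<close>. The premises of the \<open>mu\<close>
  rule provide a value for every candidate up to \<open>n\<close>, zero only at \<open>n\<close>, so
  the loop stops exactly there, with its scratch cell already empty.\<close>

lemma compiled_Mu:
  assumes f: "compiled f"
  shows "compiled (Mu f)"
  unfolding compiled_def
proof (intro allI impI)
  fix xs n ds q t
  assume c: "computes (Mu f) xs n" and env: "env q t ds xs" and t: "\<forall>i\<ge>q. t i = 0"
  from c have "computes f (n # xs) 0" "\<forall>m<n. \<exists>k. computes f (m # xs) (Suc k)"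
    by (cases; simp)+
  then have "\<forall>m\<le>n. \<exists>k. computes f (m # xs) k \<and> (k = 0 \<longleftrightarrow> m = n)"
    by (metis le_neq_implies_less nat.distinct(1) order_less_irrefl)
  then obtain v where v: "\<And>m. m \<le> n \<Longrightarrow> computes f (m # xs) (v m)" "\<And>m. m \<le> n \<Longrightarrow> v m = 0 \<longleftrightarrow> m = n"
    by metis
  define C where "C = compile f (1 # map Suc ds)"
  define B where "B = Loop [Dec] # Lt # Inc # Rt # C"
  define T where "T m = t(q := m, q + 1 := v m)" for m
  have C: "exec C (q + 1) (t(q := m)) (q + 1) (T m)" if "m \<le> n" for m
    unfolding C_def T_def
  proof (rule compiledD[OF f v(1)[OF that]])
    have "env (q + 1) (t(q := m)) (map Suc ds) xs"
      using env_shift_Suc[OF env] by simp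
    then show "env (q + 1) (t(q := m)) (1 # map Suc ds) (m # xs)"
      by simp
  qed (use t in simp)
  have body: "exec B (q + 1) (T m) (q + 1) (T (Suc m))" if m: "m < n" for m
  proof -
    have "exec [Loop [Dec]] (q + 1) (T m) (q + 1) (t(q := m))"
    proof -
      have "(T m)(q + 1 := 0) = t(q := m)"
        using t by (auto simp: T_def fun_eq_iff)
      then show ?thesis using exec_clear[of "q + 1" "T m"] by simp
    qed
    also have "exec [Lt] (q + 1) (t(q := m)) q (t(q := m))"
      using exec_single(3)[of q] by simp
    also have "exec [Inc] q (t(q := m)) q (t(q := Suc m))"
      using exec_single(1)[of q "t(q := m)"] by simp
    also have "exec [Rt] q (t(q := Suc m)) (q + 1) (t(q := Suc m))"
      using exec_single(4)[of q] by simp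
    also have "exec C (q + 1) (t(q := Suc m)) (q + 1) (T (Suc m))"
      using m by (intro C) simp
    finally show ?thesis by (simp add: B_def)
  qed
  have loop: "exec [Loop B] (q + 1) (T m) (q + 1) (T n)" if "m \<le> n" for m
    using that
  proof (induction rule: inc_induct)
    case base
    then show ?case using v(2)[of n] by (intro exec_Loop_0 exec_Nil) (simp add: T_def)
  next
    case (step m)
    then have "0 < T m (q + 1)" using v(2)[of m] by (simp add: T_def)
    from exec_Loop_Suc[OF this body step.IH] step.hyps show ?case by simp
  qed
  have "exec [Rt] q t (q + 1) t"
    using exec_single(4)[of q t] by simp
  also have "exec C (q + 1) t (q + 1) (T 0)"
  proof -
    have "t(q := 0) = t" using t by auto
    then show ?thesis using C[of 0] by simp
  qed
  also have "exec [Loop B] (q + 1) (T 0) (q + 1) (T n)"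
    by (rule loop) simp
  also have "exec [Lt] (q + 1) (T n) q (t(q := n))"
  proof -
    have "T n = t(q := n)"
      using t v(2)[of n] by (auto simp: T_def fun_eq_iff)
    then show ?thesis using exec_single(3)[of q "T n"] by simp
  qed
  finally show "exec (compile (Mu f) ds) q t q (t(q := n))"
    by (simp add: B_def C_def)
qed

lemma compiled: "compiled f"
proof (induction f)
  case Zero
  have "t = t(q := 0)" if "\<forall>i\<ge>q. t i = 0" for t :: "nat \<Rightarrow> nat" and q
    using that by auto
  then show ?case
    unfolding compiled_def by (auto elim!: computes.cases[of Zero]) (metis exec_Nil)
next
  case Succ
  show ?case
    unfolding compiled_def
  proof (intro allI impI)
    fix xs y ds q t
    assume c: "computes Succ xs y" and env: "env q t ds xs" and t: "\<forall>i\<ge>q. t i = 0"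
    from c obtain x where x: "xs = [x]" "y = Suc x"
      by cases auto
    with env obtain d where d: "ds = [d]" "0 < d" "d \<le> q" "t (q - d) = x"
      by (auto simp: env_def list_all2_Cons2)
    have "exec (copy_from d) q t q (t(q := x))"
      using exec_copy_from[of d q t] d t by simp
    also have "exec [Inc] q (t(q := x)) q (t(q := y))"
      using exec_single(1)[of q "t(q := x)"] x by simp
    finally show "exec (compile Succ ds) q t q (t(q := y))"
      by (simp add: d(1))
  qed
next
  case (Proj i)
  show ?case
    unfolding compiled_def
  proof (intro allI impI)
    fix xs y ds q t
    assume c: "computes (Proj i) xs y" and env: "env q t ds xs" and t: "\<forall>i\<ge>q. t i = 0"
    from c have i: "i < length xs" "y = xs ! i"
      by (cases; simp)+
    with env have "0 < ds ! i" "ds ! i \<le> q" "t (q - ds ! i) = y"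
      by (auto simp: env_def list_all2_conv_all_nth)
    then show "exec (compile (Proj i) ds) q t q (t(q := y))"
      using exec_copy_from[of "ds ! i" q t] t by simp
  qed
next
  case (Comp f gs) then show ?case by (intro compiled_Comp) auto
next
  case (PrimRec f g) then show ?case by (intro compiled_PrimRec)
next
  case (Mu f) then show ?case by (intro compiled_Mu)
qed

section \<open>A rewriting system interpreting the counter language\<close>

datatype sym = One | Bar | At | Semi | Caret | Plus | Minus | ToLeft | ToRight | Open | Active
  | Close | Mark | Count | LeftEnd | RightEnd

text \<open>What the head brings back from the tape to the instruction marked by
  \<open>Caret\<close>: the operation is done, or the outcome of a loop test.\<close>

datatype reply = Proceed | Enter | Skip

datatype state = Run | Back | Find sym | Remove | GoLeft | GoRight | Test | Return reply
  | Resume reply | Scan | Carry sym | Decrement | Unmark | Final | EraseRight | EraseLeft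
  | Accept | Reject

primrec reads_left :: "state \<Rightarrow> bool" where
  "reads_left Run = False"
| "reads_left Back = True"
| "reads_left (Find a) = True"
| "reads_left Remove = True"
| "reads_left GoLeft = True"
| "reads_left GoRight = False"
| "reads_left Test = True"
| "reads_left (Return r) = False"
| "reads_left (Resume r) = False"
| "reads_left Scan = False"
| "reads_left (Carry a) = True"
| "reads_left Decrement = False"
| "reads_left Unmark = True"
| "reads_left Final = True"
| "reads_left EraseRight = False"
| "reads_left EraseLeft = True"
| "reads_left Accept = True"
| "reads_left Reject = True"

text \<open>
  A configuration is a word \<open>LeftEnd tape Semi program RightEnd\<close> with the head somewhere in it. Cell \<open>i\<close> of
  the tape is a block of \<open>One\<close>s closed by \<open>Bar\<close>, or by \<open>At\<close> if the pointer is there. In state \<open>Run\<close> the head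
  is left of the next instruction. A loop being executed has its \<open>Open\<close> replaced by \<open>Active\<close>, so the
  loop to be repeated is the one whose \<open>Active\<close> is nearest to the left. To skip a loop, the head carries
  \<open>Mark\<close> and a counter of the nesting depth along.
  If \<open>delta q x = Some (u, q', v)\<close>, the letter \<open>x\<close> next to the head is replaced by \<open>u\<close> on the left and \<open>v\<close>
  on the right of the head.
\<close>

primrec delta :: "state \<Rightarrow> sym \<Rightarrow> (sym list \<times> state \<times> sym list) option" where
  "delta Run x = (if x = Close then Some ([], Back, [Close]) else Some ([], Find x, [Caret, x]))"
| "delta Back x = (if x = Active then Some ([], Run, [Open]) else Some ([], Back, [x]))"
| "delta (Find a) x = (if x \<noteq> At then Some ([], Find a, [x]) else
     (case a of
        Plus \<Rightarrow> Some ([One], Return Proceed, [At])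
      | Minus \<Rightarrow> Some ([], Remove, [At])
      | ToLeft \<Rightarrow> Some ([], GoLeft, [Bar])
      | ToRight \<Rightarrow> Some ([Bar], GoRight, [])
      | Open \<Rightarrow> Some ([], Test, [At])
      | RightEnd \<Rightarrow> Some ([], Final, [At])
      | _ \<Rightarrow> None))"
| "delta Remove x = Some (if x = One then [] else [x], Return Proceed, [])"
| "delta GoLeft x = (if x = Bar then Some ([], Return Proceed, [At]) else Some ([], GoLeft, [x]))"
| "delta GoRight x = (if x = Bar then Some ([], Return Proceed, [At])
     else if x = Semi then Some ([], Return Proceed, [At, Semi]) else Some ([x], GoRight, []))"
| "delta Test x = Some ([x], Return (if x = One then Enter else Skip), [])"
| "delta (Return r) x = (if x = Caret then Some ([], Resume r, []) else Some ([x], Return r, []))"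
| "delta (Resume r) x = (case r of
        Proceed \<Rightarrow> Some ([x], Run, [])
      | Enter \<Rightarrow> Some ([Active], Run, [])
      | Skip \<Rightarrow> Some ([Open, Mark], Scan, []))"
| "delta Scan x = (if x = Count then Some ([Count], Scan, []) else Some ([], Carry x, []))"
| "delta (Carry a) x = (if x \<noteq> Mark then Some ([], Carry a, [x])
     else if a = Open then Some ([Open, Mark, Count], Scan, [])
     else if a = Close then Some ([Close, Mark], Decrement, [])
     else Some ([a, Mark], Scan, []))"
| "delta Decrement x = (if x = Count then Some ([], Scan, []) else Some ([], Unmark, [x]))"
| "delta Unmark x = Some ([], Run, [])"
| "delta Final x = (if x = One then Some ([], Reject, []) else Some ([x], EraseRight, []))"
| "delta EraseRight x = Some ([], if x = RightEnd then EraseLeft else EraseRight, [])"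
| "delta EraseLeft x = Some ([], if x = LeftEnd then Accept else EraseLeft, [])"
| "delta Accept x = None"
| "delta Reject x = None"

text \<open>The part of the word left of the head is reversed.\<close>

type_synonym config = "sym list \<times> state \<times> sym list"

definition move :: "config \<Rightarrow> config option" where
  "move c = (case c of (ls, q, rs) \<Rightarrow>
     if reads_left q then
       (case ls of [] \<Rightarrow> None
        | x # ls' \<Rightarrow> map_option (\<lambda>(u, q', v). (rev u @ ls', q', v @ rs)) (delta q x))
     else
       (case rs of [] \<Rightarrow> None
        | x # rs' \<Rightarrow> map_option (\<lambda>(u, q', v). (rev u @ ls, q', v @ rs')) (delta q x)))"

abbreviation reaches :: "config \<Rightarrow> config \<Rightarrow> bool" where
  "reaches \<equiv> (\<lambda>c d. move c = Some d)\<^sup>*\<^sup>*"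

lemma reaches_trans [trans]: "reaches c d \<Longrightarrow> reaches d e \<Longrightarrow> reaches c e"
  by (rule rtranclp_trans)

lemma reaches_move: "move c = Some d \<Longrightarrow> reaches c d"
  by (rule r_into_rtranclp)

lemma move_simps [simp]:
  "reads_left q \<Longrightarrow> move (x # ls, q, rs) = map_option (\<lambda>(u, q', v). (rev u @ ls, q', v @ rs)) (delta q x)"
  "\<not> reads_left q \<Longrightarrow> move (ls, q, x # rs) = map_option (\<lambda>(u, q', v). (rev u @ ls, q', v @ rs)) (delta q x)"
  by (simp_all add: move_def)

lemma pass_left:
  assumes "reads_left q" "\<And>x. x \<in> set xs \<Longrightarrow> delta q x = Some ([], q, [x])"
  shows "reaches (xs @ ls, q, rs) (ls, q, rev xs @ rs)"
  using assms(2)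
proof (induction xs arbitrary: rs)
  case (Cons x xs)
  have "reaches (x # xs @ ls, q, rs) (xs @ ls, q, x # rs)"
    using Cons.prems assms(1) by (intro reaches_move) simp
  also have "reaches \<dots> (ls, q, rev xs @ x # rs)"
    using Cons.prems by (intro Cons.IH) simp
  finally show ?case by simp
qed simp

lemma pass_right:
  assumes "\<not> reads_left q" "\<And>x. x \<in> set xs \<Longrightarrow> delta q x = Some ([x], q, [])"
  shows "reaches (ls, q, xs @ rs) (rev xs @ ls, q, rs)"
  using assms(2)
proof (induction xs arbitrary: ls)
  case (Cons x xs)
  have "reaches (ls, q, x # xs @ rs) (x # ls, q, xs @ rs)"
    using Cons.prems assms(1) by (intro reaches_move) simp
  also have "reaches \<dots> (rev xs @ x # ls, q, rs)"
    using Cons.prems by (intro Cons.IH) simp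
  finally show ?case by simp
qed simp

text \<open>\<open>Caret\<close> marks the place to return to, while the instruction travels to the
  tape inside the state. As \<open>Z\<close> contains no \<open>At\<close>, the first one met is the
  pointer.\<close>

lemma reaches_Find:
  assumes "At \<notin> set Z" "x \<noteq> Close"
  shows "reaches (Z @ At # L, Run, x # ys) (At # L, Find x, rev Z @ Caret # x # ys)"
proof -
  have "reaches (Z @ At # L, Run, x # ys) (Z @ At # L, Find x, Caret # x # ys)"
    using assms(2) by (intro reaches_move) simp
  also have "reaches \<dots> (At # L, Find x, rev Z @ Caret # x # ys)"
    using assms(1) by (intro pass_left) auto
  finally show ?thesis .
qed

lemma reaches_Resume:
  assumes "Caret \<notin> set V"
  shows "reaches (L, Return r, V @ Caret # x # ys) (rev V @ L, Resume r, x # ys)"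
proof -
  have "reaches (L, Return r, V @ Caret # x # ys) (rev V @ L, Return r, Caret # x # ys)"
    using assms by (intro pass_right) auto
  also have "reaches \<dots> (rev V @ L, Resume r, x # ys)"
    by (intro reaches_move) simp
  finally show ?thesis .
qed

lemma reaches_Proceed:
  assumes "Caret \<notin> set V"
  shows "reaches (L, Return Proceed, V @ Caret # x # ys) (x # rev V @ L, Run, ys)"
proof -
  note reaches_Resume[OF assms]
  also have "reaches (rev V @ L, Resume Proceed, x # ys) (x # rev V @ L, Run, ys)"
    by (intro reaches_move) simp
  finally show ?thesis .
qed

section \<open>Tape and program as words\<close>

primrec cells_left :: "(nat \<Rightarrow> nat) \<Rightarrow> nat \<Rightarrow> sym list" where
  "cells_left t 0 = [LeftEnd]"
| "cells_left t (Suc p) = Bar # replicate (t p) One @ cells_left t p"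

definition cells_right :: "(nat \<Rightarrow> nat) \<Rightarrow> nat \<Rightarrow> nat \<Rightarrow> sym list" where
  "cells_right t p N = concat (map (\<lambda>i. replicate (t i) One @ [Bar]) [Suc p..<N])"

text \<open>Reversed, to fit the left part of a configuration. Only the first \<open>N\<close> cells
  are written out; in the simulation all cells from \<open>N\<close> on are 0.\<close>

definition tape :: "nat \<Rightarrow> nat \<Rightarrow> (nat \<Rightarrow> nat) \<Rightarrow> sym list" where
  "tape N p t = Semi # rev (cells_right t p N) @ At # replicate (t p) One @ cells_left t p"

lemma cells_left_update [simp]: "p \<le> i \<Longrightarrow> cells_left (t(i := y)) p = cells_left t p"
  by (induction p) auto

lemma cells_right_update [simp]: "i \<le> p \<Longrightarrow> cells_right (t(i := y)) p N = cells_right t p N"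
  by (auto simp: cells_right_def intro!: arg_cong[where f = concat])

lemma cells_right_Suc:
  "Suc p < N \<Longrightarrow> cells_right t p N = replicate (t (Suc p)) One @ Bar # cells_right t (Suc p) N"
  by (simp add: cells_right_def upt_conv_Cons)

lemma cells_right_Nil: "N \<le> Suc p \<Longrightarrow> cells_right t p N = []"
  by (simp add: cells_right_def)

lemma set_cells_right: "set (cells_right t p N) \<subseteq> {One, Bar}"
  by (auto simp: cells_right_def split: if_splits)

primrec symbols :: "instr \<Rightarrow> sym list" where
  "symbols Inc = [Plus]"
| "symbols Dec = [Minus]"
| "symbols Lt = [ToLeft]"
| "symbols Rt = [ToRight]"
| "symbols (Loop B) = Open # concat (map symbols B) @ [Close]"

definition program :: "instr list \<Rightarrow> sym list" where
  "program P = concat (map symbols P)"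

lemma program_simps [simp]:
  "program [] = []" "program (i # P) = symbols i @ program P"
  by (simp_all add: program_def)

lemma symbols_Loop [simp]: "symbols (Loop B) = Open # program B @ [Close]"
  by (simp add: program_def)

declare symbols.simps(5) [simp del]

lemma set_symbols: "set (symbols i) \<subseteq> {Plus, Minus, ToLeft, ToRight, Open, Close}"
  by (induction i) (auto simp: program_def)

lemma set_program: "set (program P) \<subseteq> {Plus, Minus, ToLeft, ToRight, Open, Close}"
  using set_symbols by (fastforce simp: program_def)

section \<open>Skipping a loop by counting nesting depth\<close>

lemma reaches_Carry:
  "a \<noteq> Count \<Longrightarrow> reaches (replicate k Count @ Mark # Q, Scan, a # ys)
     (Mark # Q, Carry a, replicate k Count @ ys)"
proof -
  assume "a \<noteq> Count"
  then have "reaches (replicate k Count @ Mark # Q, Scan, a # ys)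
      (replicate k Count @ Mark # Q, Carry a, ys)"
    by (intro reaches_move) simp
  also have "reaches \<dots> (Mark # Q, Carry a, rev (replicate k Count) @ ys)"
    by (intro pass_left) auto
  finally show ?thesis by simp
qed

lemma reaches_Count:
  "reaches (L, Scan, replicate k Count @ ys) (replicate k Count @ L, Scan, ys)"
  using pass_right[of Scan "replicate k Count" L ys] by simp

lemma scan_plain:
  assumes "a \<notin> {Count, Open, Close}"
  shows "reaches (replicate k Count @ Mark # Q, Scan, a # ys)
    (replicate k Count @ Mark # a # Q, Scan, ys)"
proof -
  have "reaches (replicate k Count @ Mark # Q, Scan, a # ys)
      (Mark # Q, Carry a, replicate k Count @ ys)"
    using assms by (intro reaches_Carry) auto
  also have "reaches \<dots> (Mark # a # Q, Scan, replicate k Count @ ys)"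
    using assms by (intro reaches_move) auto
  also have "reaches \<dots> (replicate k Count @ Mark # a # Q, Scan, ys)"
    by (rule reaches_Count)
  finally show ?thesis .
qed

lemma scan_Open:
  "reaches (replicate k Count @ Mark # Q, Scan, Open # ys)
    (replicate (Suc k) Count @ Mark # Open # Q, Scan, ys)"
proof -
  have "reaches (replicate k Count @ Mark # Q, Scan, Open # ys)
      (Mark # Q, Carry Open, replicate k Count @ ys)"
    by (intro reaches_Carry) auto
  also have "reaches \<dots> (Count # Mark # Open # Q, Scan, replicate k Count @ ys)"
    by (intro reaches_move) auto
  also have "reaches \<dots> (replicate k Count @ Count # Mark # Open # Q, Scan, ys)"
    by (rule reaches_Count)
  finally show ?thesis by (simp add: replicate_app_Cons_same)
qed

lemma scan_Close:
  "reaches (replicate k Count @ Mark # Q, Scan, Close # ys)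
    (Mark # Close # Q, Decrement, replicate k Count @ ys)"
proof -
  have "reaches (replicate k Count @ Mark # Q, Scan, Close # ys)
      (Mark # Q, Carry Close, replicate k Count @ ys)"
    by (intro reaches_Carry) auto
  also have "reaches \<dots> (Mark # Close # Q, Decrement, replicate k Count @ ys)"
    by (intro reaches_move) auto
  finally show ?thesis .
qed

text \<open>The claim for single instructions is a premise, so that the lemma can be applied to loop
  bodies within the induction over \<open>instr\<close>.\<close>

lemma scan_program_if:
  assumes "\<And>i k Q ys. i \<in> set P \<Longrightarrow> reaches (replicate k Count @ Mark # Q, Scan, symbols i @ ys)
    (replicate k Count @ Mark # rev (symbols i) @ Q, Scan, ys)"
  shows "reaches (replicate k Count @ Mark # Q, Scan, program P @ ys)
    (replicate k Count @ Mark # rev (program P) @ Q, Scan, ys)"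
  using assms
proof (induction P arbitrary: Q)
  case (Cons i P)
  have "reaches (replicate k Count @ Mark # Q, Scan, symbols i @ program P @ ys)
      (replicate k Count @ Mark # rev (symbols i) @ Q, Scan, program P @ ys)"
    by (rule Cons.prems) simp
  also have "reaches \<dots> (replicate k Count @ Mark # rev (program P) @ rev (symbols i) @ Q, Scan, ys)"
    by (intro Cons.IH Cons.prems) simp
  finally show ?case by simp
qed simp

text \<open>The letters of the program are carried one by one to the left of the block of
  \<open>Mark\<close> and counters. Brackets are balanced within an instruction, so the depth
  returns to \<open>k\<close>; it must be arbitrary in the induction since a body is scanned at
  depth \<open>Suc k\<close>.\<close>

lemma scan_symbols:
  "reaches (replicate k Count @ Mark # Q, Scan, symbols i @ ys)
    (replicate k Count @ Mark # rev (symbols i) @ Q, Scan, ys)"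
proof (induction i arbitrary: k Q ys)
  case (Loop B)
  let ?Q = "rev (program B) @ Open # Q"
  have "reaches (replicate k Count @ Mark # Q, Scan, Open # program B @ Close # ys)
      (replicate (Suc k) Count @ Mark # Open # Q, Scan, program B @ Close # ys)"
    by (rule scan_Open)
  also have "reaches \<dots> (replicate (Suc k) Count @ Mark # ?Q, Scan, Close # ys)"
    by (rule scan_program_if) (rule Loop)
  also have "reaches \<dots> (Mark # Close # ?Q, Decrement, replicate (Suc k) Count @ ys)"
    by (rule scan_Close)
  also have "reaches \<dots> (Mark # Close # ?Q, Scan, replicate k Count @ ys)"
    by (rule reaches_move) simp
  also have "reaches \<dots> (replicate k Count @ Mark # Close # ?Q, Scan, ys)"
    by (rule reaches_Count)
  finally show ?case by simp
qed (auto intro: scan_plain)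

text \<open>The matching bracket is the \<open>Close\<close> that meets an empty counter. Emptiness
  is recognised by reading the following letter, which therefore has to exist and differ from
  \<open>Count\<close>.\<close>

lemma skip_loop:
  assumes "y \<noteq> Count"
  shows "reaches (Mark # Q, Scan, program B @ Close # y # ys) (Close # rev (program B) @ Q, Run, y # ys)"
proof -
  let ?Q = "rev (program B) @ Q"
  have "reaches (Mark # Q, Scan, program B @ Close # y # ys) (Mark # ?Q, Scan, Close # y # ys)"
    using scan_program_if[of B 0, OF scan_symbols] by simp
  also have "reaches \<dots> (Mark # Close # ?Q, Decrement, y # ys)"
    using scan_Close[of 0] by simp
  also have "reaches \<dots> (Mark # Close # ?Q, Unmark, y # ys)"
    using assms by (intro reaches_move) simp
  also have "reaches \<dots> (Close # ?Q, Run, y # ys)"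
    by (intro reaches_move) simp
  finally show ?thesis .
qed

text \<open>Holds for the program text between tape and head: the nearest \<open>At\<close> is then
  the pointer and the nearest \<open>Caret\<close> the return mark. \<open>Active\<close> is
  allowed, as enclosing loops may be running.\<close>

definition plain :: "sym list \<Rightarrow> bool" where
  "plain Q \<longleftrightarrow> At \<notin> set Q \<and> Caret \<notin> set Q"

lemma plain_simps [simp]:
  "plain []" "plain (x # Q) \<longleftrightarrow> x \<noteq> At \<and> x \<noteq> Caret \<and> plain Q"
  "plain (Q @ Q') \<longleftrightarrow> plain Q \<and> plain Q'" "plain (rev Q) \<longleftrightarrow> plain Q"
  by (auto simp: plain_def)

lemma plain_program [simp]: "plain (program P)"
  using set_program[of P] by (auto simp: plain_def)

lemma plain_cells_right [simp]: "plain (cells_right t p N)"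
  using set_cells_right[of t p N] by (auto simp: plain_def)

section \<open>Simulation of single instructions\<close>

lemma run_Plus:
  assumes "plain Q"
  shows "reaches (Q @ tape N p t, Run, Plus # ys) (Plus # Q @ tape N p (t(p := Suc (t p))), Run, ys)"
proof -
  define Z where "Z = Q @ Semi # rev (cells_right t p N)"
  define L where "L = replicate (t p) One @ cells_left t p"
  have Z: "At \<notin> set Z" "Caret \<notin> set (At # rev Z)"
    using assms plain_cells_right[of t p N] by (auto simp: Z_def plain_def)
  have "reaches (Z @ At # L, Run, Plus # ys) (At # L, Find Plus, rev Z @ Caret # Plus # ys)"
    using Z(1) by (intro reaches_Find) auto
  also have "reaches \<dots> (One # L, Return Proceed, (At # rev Z) @ Caret # Plus # ys)"
    by (intro reaches_move) simp
  also have "reaches \<dots> (Plus # rev (At # rev Z) @ One # L, Run, ys)"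
    using Z(2) by (rule reaches_Proceed)
  finally show ?thesis by (simp add: Z_def L_def tape_def)
qed

lemma run_Minus:
  assumes "plain Q"
  shows "reaches (Q @ tape N p t, Run, Minus # ys) (Minus # Q @ tape N p (t(p := t p - 1)), Run, ys)"
proof -
  define Z where "Z = Q @ Semi # rev (cells_right t p N)"
  define L where "L = replicate (t p) One @ cells_left t p"
  define L' where "L' = replicate (t p - 1) One @ cells_left t p"
  have Z: "At \<notin> set Z" "Caret \<notin> set (At # rev Z)"
    using assms plain_cells_right[of t p N] by (auto simp: Z_def plain_def)
  have "reaches (Z @ At # L, Run, Minus # ys) (At # L, Find Minus, rev Z @ Caret # Minus # ys)"
    using Z(1) by (intro reaches_Find) auto
  also have "reaches \<dots> (L, Remove, (At # rev Z) @ Caret # Minus # ys)"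
    by (intro reaches_move) simp
  \<comment> \<open>In an empty cell the letter next to \<open>At\<close> is \<open>Bar\<close>, or
    \<open>LeftEnd\<close> in cell 0, and \<open>Remove\<close> puts it back; this matches truncated
    subtraction.\<close>
  also have "reaches \<dots> (L', Return Proceed, (At # rev Z) @ Caret # Minus # ys)"
    by (intro reaches_move, cases "t p"; cases p) (simp_all add: L_def L'_def)
  also have "reaches \<dots> (Minus # rev (At # rev Z) @ L', Run, ys)"
    using Z(2) by (rule reaches_Proceed)
  finally show ?thesis by (simp add: Z_def L_def L'_def tape_def)
qed

lemma run_ToLeft:
  assumes "plain Q" "Suc p < N"
  shows "reaches (Q @ tape N (Suc p) t, Run, ToLeft # ys) (ToLeft # Q @ tape N p t, Run, ys)"
proof -
  define Z where "Z = Q @ Semi # rev (cells_right t (Suc p) N)"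
  define L where "L = replicate (t p) One @ cells_left t p"
  define k where "k = t (Suc p)"
  define V where "V = At # replicate k One @ Bar # rev Z"
  have Z: "At \<notin> set Z" "Caret \<notin> set V"
    using assms plain_cells_right[of t "Suc p" N] by (auto simp: Z_def V_def plain_def)
  have "reaches (Z @ At # replicate k One @ Bar # L, Run, ToLeft # ys)
      (At # replicate k One @ Bar # L, Find ToLeft, rev Z @ Caret # ToLeft # ys)"
    using Z(1) by (intro reaches_Find) auto
  also have "reaches \<dots> (replicate k One @ Bar # L, GoLeft, Bar # rev Z @ Caret # ToLeft # ys)"
    by (intro reaches_move) simp
  also have "reaches \<dots> (Bar # L, GoLeft, rev (replicate k One) @ Bar # rev Z @ Caret # ToLeft # ys)"
    by (intro pass_left) auto
  also have "reaches \<dots> (L, Return Proceed, V @ Caret # ToLeft # ys)"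
    by (intro reaches_move) (simp add: V_def)
  also have "reaches \<dots> (ToLeft # rev V @ L, Run, ys)"
    using Z(2) by (rule reaches_Proceed)
  finally show ?thesis
    using assms(2) by (simp add: Z_def L_def V_def k_def tape_def cells_right_Suc)
qed

lemma run_ToRight:
  assumes "plain Q" "Suc p < N"
  shows "reaches (Q @ tape N p t, Run, ToRight # ys) (ToRight # Q @ tape N (Suc p) t, Run, ys)"
proof -
  define Z where "Z = Q @ Semi # rev (cells_right t p N)"
  define L where "L = replicate (t p) One @ cells_left t p"
  define k where "k = t (Suc p)"
  define W where "W = cells_right t (Suc p) N @ Semi # rev Q"
  have W: "rev Z = replicate k One @ Bar # W"
    using assms(2) by (simp add: Z_def W_def k_def cells_right_Suc)
  have Z: "At \<notin> set Z" "Caret \<notin> set (At # W)"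
    using assms plain_cells_right[of t p N] plain_cells_right[of t "Suc p" N]
    by (auto simp: Z_def W_def plain_def)
  have "reaches (Z @ At # L, Run, ToRight # ys) (At # L, Find ToRight, rev Z @ Caret # ToRight # ys)"
    using Z(1) by (intro reaches_Find) auto
  also have "reaches \<dots> (Bar # L, GoRight, replicate k One @ Bar # W @ Caret # ToRight # ys)"
    by (intro reaches_move) (simp add: W)
  also have "reaches \<dots> (rev (replicate k One) @ Bar # L, GoRight, Bar # W @ Caret # ToRight # ys)"
    by (intro pass_right) auto
  also have "reaches \<dots> (replicate k One @ Bar # L, Return Proceed, (At # W) @ Caret # ToRight # ys)"
    by (intro reaches_move) simp
  also have "reaches \<dots> (ToRight # rev (At # W) @ replicate k One @ Bar # L, Run, ys)"
    using Z(2) by (rule reaches_Proceed)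
  finally show ?thesis
    by (simp add: Z_def L_def W_def k_def tape_def)
qed

text \<open>The pointer stands on the last written cell: the head runs into \<open>Semi\<close> and
  inserts a fresh empty cell before it.\<close>

lemma run_ToRight_extend:
  assumes "plain Q" "t (Suc p) = 0"
  shows "reaches (Q @ tape (Suc p) p t, Run, ToRight # ys)
    (ToRight # Q @ tape (Suc (Suc p)) (Suc p) t, Run, ys)"
proof -
  define L where "L = replicate (t p) One @ cells_left t p"
  define Z where "Z = Q @ [Semi]"
  have Z: "At \<notin> set Z" "Caret \<notin> set (At # rev Z)"
    using assms by (auto simp: Z_def plain_def)
  have "reaches (Z @ At # L, Run, ToRight # ys) (At # L, Find ToRight, rev Z @ Caret # ToRight # ys)"
    using Z(1) by (intro reaches_Find) auto
  also have "reaches \<dots> (Bar # L, GoRight, rev Z @ Caret # ToRight # ys)"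
    by (intro reaches_move) simp
  also have "reaches \<dots> (Bar # L, Return Proceed, (At # rev Z) @ Caret # ToRight # ys)"
    by (intro reaches_move) (simp add: Z_def)
  also have "reaches \<dots> (ToRight # rev (At # rev Z) @ Bar # L, Run, ys)"
    using Z(2) by (rule reaches_Proceed)
  finally show ?thesis
    by (simp add: Z_def L_def tape_def cells_right_Nil assms(2))
qed

lemma run_test:
  assumes "plain Q"
  shows "reaches (Q @ tape N p t, Run, Open # ys)
    (Q @ tape N p t, Resume (if t p = 0 then Skip else Enter), Open # ys)"
proof -
  define Z where "Z = Q @ Semi # rev (cells_right t p N)"
  define L where "L = replicate (t p) One @ cells_left t p"
  have Z: "At \<notin> set Z" "Caret \<notin> set (At # rev Z)"
    using assms plain_cells_right[of t p N] by (auto simp: Z_def plain_def)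
  have "reaches (Z @ At # L, Run, Open # ys) (At # L, Find Open, rev Z @ Caret # Open # ys)"
    using Z(1) by (intro reaches_Find) auto
  also have "reaches \<dots> (L, Test, (At # rev Z) @ Caret # Open # ys)"
    by (intro reaches_move) simp
  also have "reaches \<dots> (L, Return (if t p = 0 then Skip else Enter), (At # rev Z) @ Caret # Open # ys)"
    by (intro reaches_move, cases "t p"; cases p) (simp_all add: L_def)
  also have "reaches \<dots> (rev (At # rev Z) @ L, Resume (if t p = 0 then Skip else Enter), Open # ys)"
    using Z(2) by (rule reaches_Resume)
  finally show ?thesis by (simp add: Z_def L_def tape_def)
qed

lemma run_Open_0:
  assumes "plain Q" "t p = 0" "y \<noteq> Count"
  shows "reaches (Q @ tape N p t, Run, symbols (Loop B) @ y # ys)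
    (rev (symbols (Loop B)) @ Q @ tape N p t, Run, y # ys)"
proof -
  let ?T = "Q @ tape N p t"
  have "reaches (?T, Run, Open # program B @ Close # y # ys)
      (?T, Resume Skip, Open # program B @ Close # y # ys)"
    using run_test[OF assms(1), of N p t] assms(2) by simp
  also have "reaches \<dots> (Mark # Open # ?T, Scan, program B @ Close # y # ys)"
    by (intro reaches_move) simp
  also have "reaches \<dots> (Close # rev (program B) @ Open # ?T, Run, y # ys)"
    using assms(3) by (rule skip_loop)
  finally show ?thesis by simp
qed

lemma run_Open_Suc:
  assumes "plain Q" "t p > 0"
  shows "reaches (Q @ tape N p t, Run, Open # ys) (Active # Q @ tape N p t, Run, ys)"
proof -
  let ?T = "Q @ tape N p t"
  have "reaches (?T, Run, Open # ys) (?T, Resume Enter, Open # ys)"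
    using run_test[OF assms(1), of N p t] assms(2) by simp
  also have "reaches \<dots> (Active # ?T, Run, ys)"
    by (intro reaches_move) simp
  finally show ?thesis .
qed

text \<open>No \<open>Active\<close> survives inside the body, so the nearest one belongs to this
  bracket. It turns back into \<open>Open\<close> with the head in front of it, ready for the next
  test.\<close>

lemma run_Close:
  "reaches (rev (program B) @ Active # T, Run, Close # ys) (T, Run, symbols (Loop B) @ ys)"
proof -
  have "reaches (rev (program B) @ Active # T, Run, Close # ys)
      (rev (program B) @ Active # T, Back, Close # ys)"
    by (intro reaches_move) simp
  also have "reaches \<dots> (Active # T, Back, rev (rev (program B)) @ Close # ys)"
    using set_program[of B] by (intro pass_left) auto
  also have "reaches \<dots> (T, Run, Open # program B @ Close # ys)"
    by (intro reaches_move) simp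
  finally show ?thesis by simp
qed

text \<open>The word \<open>Q\<close> is generalised because the bodies of loops run with program
  text and \<open>Active\<close> signs on their left, and \<open>N\<close> because the tape may
  grow. The letter \<open>y\<close> provides the lookahead needed after a skipped loop.\<close>

lemma exec_reaches:
  assumes "exec P p t p' t'" "plain Q" "p < N" "\<And>i. i \<ge> N \<Longrightarrow> t i = 0" "y \<noteq> Count"
  shows "\<exists>N'. p' < N' \<and> (\<forall>i\<ge>N'. t' i = 0) \<and>
    reaches (Q @ tape N p t, Run, program P @ y # ys) (rev (program P) @ Q @ tape N' p' t', Run, y # ys)"
  using assms
proof (induction arbitrary: Q N y ys rule: exec.induct)
  case (exec_Nil p t)
  then show ?case by auto
next
  case (exec_Inc P p t p' t')
  obtain N' where N': "p' < N'" "\<forall>i\<ge>N'. t' i = 0"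
    "reaches ((Plus # Q) @ tape N p (t(p := Suc (t p))), Run, program P @ y # ys)
       (rev (program P) @ (Plus # Q) @ tape N' p' t', Run, y # ys)"
  proof -
    have "\<forall>i\<ge>N. (t(p := Suc (t p))) i = 0"
      using exec_Inc.prems by auto
    with exec_Inc.IH[of "Plus # Q" N y ys] exec_Inc.prems that show ?thesis
      by (auto simp del: fun_upd_apply)
  qed
  from reaches_trans[OF run_Plus[OF exec_Inc.prems(1)] N'(3)[unfolded append_Cons]] N'(1,2) show ?case
    by (intro exI[of _ N']) simp
next
  case (exec_Dec P p t p' t')
  obtain N' where N': "p' < N'" "\<forall>i\<ge>N'. t' i = 0"
    "reaches ((Minus # Q) @ tape N p (t(p := t p - 1)), Run, program P @ y # ys)
       (rev (program P) @ (Minus # Q) @ tape N' p' t', Run, y # ys)"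
  proof -
    have "\<forall>i\<ge>N. (t(p := t p - 1)) i = 0"
      using exec_Dec.prems by auto
    with exec_Dec.IH[of "Minus # Q" N y ys] exec_Dec.prems that show ?thesis
      by (auto simp del: fun_upd_apply)
  qed
  from reaches_trans[OF run_Minus[OF exec_Dec.prems(1)] N'(3)[unfolded append_Cons]] N'(1,2) show ?case
    by (intro exI[of _ N']) simp
next
  case (exec_Lt P p t p' t')
  obtain N' where N': "p' < N'" "\<forall>i\<ge>N'. t' i = 0"
    "reaches ((ToLeft # Q) @ tape N p t, Run, program P @ y # ys)
       (rev (program P) @ (ToLeft # Q) @ tape N' p' t', Run, y # ys)"
    using exec_Lt.IH[of "ToLeft # Q" N y ys] exec_Lt.prems by auto
  from reaches_trans[OF run_ToLeft[OF exec_Lt.prems(1,2)] N'(3)[unfolded append_Cons]] N'(1,2) show ?case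
    by (intro exI[of _ N']) simp
next
  case (exec_Rt P p t p' t')
  \<comment> \<open>One cell is added exactly when the pointer leaves the written part.\<close>
  define M where "M = max N (Suc (Suc p))"
  have *: "reaches (Q @ tape N p t, Run, ToRight # zs) (ToRight # Q @ tape M (Suc p) t, Run, zs)" for zs
  proof (cases "Suc p < N")
    case True
    then show ?thesis using run_ToRight[OF exec_Rt.prems(1) True] by (simp add: M_def)
  next
    case False
    then have "N = Suc p" using exec_Rt.prems(2) by simp
    then show ?thesis using run_ToRight_extend[OF exec_Rt.prems(1)] exec_Rt.prems(3) by (simp add: M_def)
  qed
  obtain N' where N': "p' < N'" "\<forall>i\<ge>N'. t' i = 0"
    "reaches ((ToRight # Q) @ tape M (Suc p) t, Run, program P @ y # ys)
       (rev (program P) @ (ToRight # Q) @ tape N' p' t', Run, y # ys)"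
    using exec_Rt.IH[of "ToRight # Q" M y ys] exec_Rt.prems by (auto simp: M_def less_max_iff_disj)
  from reaches_trans[OF * N'(3)[unfolded append_Cons]] N'(1,2) show ?case
    by (intro exI[of _ N']) simp
next
  case (exec_Loop_0 t p P p' t' B)
  let ?Q = "rev (symbols (Loop B)) @ Q"
  obtain z zs where z: "program P @ y # ys = z # zs" "z \<noteq> Count"
    using set_program[of P] exec_Loop_0.prems(4) by (cases "program P") auto
  obtain N' where N': "p' < N'" "\<forall>i\<ge>N'. t' i = 0"
    "reaches (?Q @ tape N p t, Run, program P @ y # ys)
       (rev (program P) @ ?Q @ tape N' p' t', Run, y # ys)"
    using exec_Loop_0.IH[of ?Q N y ys] exec_Loop_0.prems by auto
  have "reaches (Q @ tape N p t, Run, symbols (Loop B) @ program P @ y # ys)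
      (?Q @ tape N p t, Run, program P @ y # ys)"
    using run_Open_0[of Q t p z N B zs] exec_Loop_0 z by simp
  also note N'(3)
  finally show ?case
    using N'(1,2) by (intro exI[of _ N']) simp
next
  case (exec_Loop_Suc t p B p1 t1 P p' t')
  \<comment> \<open>The body runs with its own \<open>Active\<close> on the left and its closing
    bracket as lookahead. Afterwards \<open>run_Close\<close> restores the original text, so the
    second induction hypothesis applies to the whole loop again.\<close>
  obtain N1 where N1: "p1 < N1" "\<forall>i\<ge>N1. t1 i = 0"
    "reaches ((Active # Q) @ tape N p t, Run, program B @ Close # program P @ y # ys)
       (rev (program B) @ (Active # Q) @ tape N1 p1 t1, Run, Close # program P @ y # ys)"
    using exec_Loop_Suc.IH(1)[of "Active # Q" N Close "program P @ y # ys"] exec_Loop_Suc.prems by auto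
  obtain N' where N': "p' < N'" "\<forall>i\<ge>N'. t' i = 0"
    "reaches (Q @ tape N1 p1 t1, Run, program (Loop B # P) @ y # ys)
       (rev (program (Loop B # P)) @ Q @ tape N' p' t', Run, y # ys)"
    using exec_Loop_Suc.IH(2)[of Q N1 y ys] exec_Loop_Suc.prems N1 by auto
  have "reaches (Q @ tape N p t, Run, program (Loop B # P) @ y # ys)
      (Active # Q @ tape N p t, Run, program B @ Close # program P @ y # ys)"
    using run_Open_Suc[of Q t p N] exec_Loop_Suc.prems exec_Loop_Suc.hyps by simp
  also have "reaches \<dots> (rev (program B) @ Active # Q @ tape N1 p1 t1, Run, Close # program P @ y # ys)"
    using N1(3) by simp
  also have "reaches \<dots> (Q @ tape N1 p1 t1, Run, program (Loop B # P) @ y # ys)"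
    using run_Close by simp
  also note N'(3)
  finally show ?case
    using N'(1,2) by blast
qed

section \<open>Reaching a terminal configuration\<close>

lemma erase_right:
  "RightEnd \<notin> set rs \<Longrightarrow> reaches (ls, EraseRight, rs @ [RightEnd]) (ls, EraseLeft, [])"
proof (induction rs)
  case Nil
  show ?case by (intro reaches_move) simp
next
  case (Cons x rs)
  then have "move (ls, EraseRight, (x # rs) @ [RightEnd]) = Some (ls, EraseRight, rs @ [RightEnd])"
    by auto
  moreover have "reaches (ls, EraseRight, rs @ [RightEnd]) (ls, EraseLeft, [])"
    using Cons by simp
  ultimately show ?case by (rule converse_rtranclp_into_rtranclp)
qed

lemma erase_left:
  "LeftEnd \<notin> set ls \<Longrightarrow> reaches (ls @ [LeftEnd], EraseLeft, []) ([], Accept, [])"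
proof (induction ls)
  case Nil
  show ?case by (intro reaches_move) simp
next
  case (Cons x ls)
  then have "move ((x # ls) @ [LeftEnd], EraseLeft, []) = Some (ls @ [LeftEnd], EraseLeft, [])"
    by auto
  moreover have "reaches (ls @ [LeftEnd], EraseLeft, []) ([], Accept, [])"
    using Cons by simp
  ultimately show ?case by (rule converse_rtranclp_into_rtranclp)
qed

lemma cells_left_end: "\<exists>L. cells_left t p = L @ [LeftEnd] \<and> LeftEnd \<notin> set L"
proof (induction p)
  case 0
  show ?case by simp
next
  case (Suc p)
  then obtain L where "cells_left t p = L @ [LeftEnd]" "LeftEnd \<notin> set L" by blast
  then show ?case by (intro exI[of _ "Bar # replicate (t p) One @ L"]) auto
qed

text \<open>Acceptance has to produce one word independent of the tape, because the end pair is
  fixed; hence everything is erased. A rejecting configuration only has to be terminal and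
  different, so there the tape may stay.\<close>

lemma finish:
  assumes "plain Q" "RightEnd \<notin> set Q" "p > 0"
  shows "\<exists>ls rs. reaches (Q @ tape N p t, Run, [RightEnd])
    (if t p = 0 then ([], Accept, []) else (ls, Reject, rs))"
proof -
  define Z where "Z = Q @ Semi # rev (cells_right t p N)"
  define L where "L = replicate (t p) One @ cells_left t p"
  define V where "V = At # rev Z @ [Caret]"
  have Z: "At \<notin> set Z" "RightEnd \<notin> set V"
    using assms plain_cells_right[of t p N] set_cells_right[of t p N]
    by (auto simp: Z_def V_def plain_def)
  have "reaches (Z @ At # L, Run, [RightEnd]) (At # L, Find RightEnd, rev Z @ Caret # [RightEnd])"
    using Z(1) by (intro reaches_Find) auto
  also have "reaches \<dots> (L, Final, V @ [RightEnd])"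
    by (intro reaches_move) (simp add: V_def)
  finally have *: "reaches (Q @ tape N p t, Run, [RightEnd]) (L, Final, V @ [RightEnd])"
    by (simp add: Z_def L_def tape_def)
  show ?thesis
  proof (cases "t p")
    case 0
    from assms(3) 0 have "reaches (L, Final, V @ [RightEnd]) (L, EraseRight, V @ [RightEnd])"
      by (intro reaches_move, cases p) (simp_all add: L_def)
    also have "reaches \<dots> (L, EraseLeft, [])"
      using Z(2) by (rule erase_right)
    also have "reaches \<dots> ([], Accept, [])"
      using cells_left_end[of t p] by (auto simp: L_def 0 intro: erase_left)
    finally show ?thesis using reaches_trans[OF *] 0 by simp
  next
    case (Suc n)
    have "reaches (L, Final, V @ [RightEnd]) (replicate n One @ cells_left t p, Reject, V @ [RightEnd])"
      by (intro reaches_move) (simp add: L_def Suc)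
    with * have "reaches (Q @ tape N p t, Run, [RightEnd])
        (replicate n One @ cells_left t p, Reject, V @ [RightEnd])"
      by (rule reaches_trans)
    with Suc show ?thesis by auto
  qed
qed

text \<open>The input lies in cell 0, so one move to the right gives an empty result cell with the
  argument at distance 1.\<close>

definition main_program :: "recf \<Rightarrow> sym list" where
  "main_program f = program (Rt # compile f [1])"

lemma computes_reaches:
  assumes "computes f [n] y"
  shows "\<exists>ls rs. reaches (tape 1 0 ((\<lambda>_. 0)(0 := n)), Run, main_program f @ [RightEnd])
    (if y = 0 then ([], Accept, []) else (ls, Reject, rs))"
proof -
  define t :: "nat \<Rightarrow> nat" where "t = (\<lambda>_. 0)(0 := n)"
  have "exec (compile f [1]) 1 t 1 (t(1 := y))"
    using assms by (intro compiledD[OF compiled]) (auto simp: t_def env_def)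
  then have "exec (Rt # compile f [1]) 0 t 1 (t(1 := y))"
    by (intro exec_Rt) simp
  from exec_reaches[OF this, of "[]" 1 RightEnd "[]"] obtain N where N: "1 < N"
    "reaches (tape 1 0 t, Run, main_program f @ [RightEnd])
      (rev (main_program f) @ tape N 1 (t(1 := y)), Run, [RightEnd])"
    by (auto simp: t_def main_program_def)
  moreover have "RightEnd \<notin> set (rev (main_program f))" "plain (rev (main_program f))"
    using set_program[of "Rt # compile f [1]"] by (auto simp: main_program_def simp del: program_simps)
  then obtain ls rs where "reaches (rev (main_program f) @ tape N 1 (t(1 := y)), Run, [RightEnd])
      (if y = 0 then ([], Accept, []) else (ls, Reject, rs))"
    using finish[of "rev (main_program f)" 1 N "t(1 := y)"] by auto
  ultimately show ?thesis
    unfolding t_def[symmetric] by (blast intro: reaches_trans)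
qed

section \<open>Configurations as words of a rewriting system\<close>

datatype letter = Sym sym | Head state

fun word :: "config \<Rightarrow> letter list" where
  "word (ls, q, rs) = map Sym (rev ls) @ Head q # map Sym rs"

definition rules :: "(letter list \<times> letter list) set" where
  "rules = {(if reads_left q then [Sym x, Head q] else [Head q, Sym x],
             map Sym u @ Head q' # map Sym v) | q x u q' v. delta q x = Some (u, q', v)}"

lemma move_imp_rewrite:
  assumes "move c = Some d"
  shows "rewrite rules (word c) (word d)"
proof -
  obtain ls q rs where c: "c = (ls, q, rs)" by (cases c)
  show ?thesis
  proof (cases "reads_left q")
    case True
    with assms c obtain x ls' u q' v where *: "ls = x # ls'" "delta q x = Some (u, q', v)"
      "d = (rev u @ ls', q', v @ rs)"
      by (auto simp: move_def split: list.splits)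
    with True have "([Sym x, Head q], map Sym u @ Head q' # map Sym v) \<in> rules"
      unfolding rules_def by force
    with * c show ?thesis
      unfolding rewrite_def
      by (intro exI[of _ "map Sym (rev ls')"] exI[of _ "map Sym rs"] exI[of _ "[Sym x, Head q]"]
          exI[of _ "map Sym u @ Head q' # map Sym v"]) simp
  next
    case False
    with assms c obtain x rs' u q' v where *: "rs = x # rs'" "delta q x = Some (u, q', v)"
      "d = (rev u @ ls, q', v @ rs')"
      by (auto simp: move_def split: list.splits)
    with False have "([Head q, Sym x], map Sym u @ Head q' # map Sym v) \<in> rules"
      unfolding rules_def by force
    with * c show ?thesis
      unfolding rewrite_def
      by (intro exI[of _ "map Sym (rev ls)"] exI[of _ "map Sym rs'"] exI[of _ "[Head q, Sym x]"]
          exI[of _ "map Sym u @ Head q' # map Sym v"]) simp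
  qed
qed

lemma unique_head:
  "map Sym xs @ Head q # map Sym ys = a @ Head q' # b \<Longrightarrow> a = map Sym xs \<and> q' = q \<and> b = map Sym ys"
proof (induction xs arbitrary: a)
  case Nil
  then show ?case by (cases a) (auto simp: map_eq_append_conv map_eq_Cons_conv)
next
  case (Cons x xs)
  then show ?case by (cases a) auto
qed

text \<open>Every left side contains a head letter and the word of a configuration has just one, so
  the place of the rewriting is forced; \<open>delta\<close> being a function then forces the
  result.\<close>

lemma rewrite_imp_move:
  assumes "rewrite rules (word c) w"
  shows "\<exists>d. move c = Some d \<and> w = word d"
proof -
  obtain ls q rs where c: "c = (ls, q, rs)" by (cases c)
  from assms obtain a b q0 x u q' v where d: "delta q0 x = Some (u, q', v)"
    and w: "w = a @ (map Sym u @ Head q' # map Sym v) @ b"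
    and e: "word c = a @ (if reads_left q0 then [Sym x, Head q0] else [Head q0, Sym x]) @ b"
    unfolding rewrite_def rules_def by blast
  show ?thesis
  proof (cases "reads_left q0")
    case True
    with e c have "map Sym (rev ls) @ Head q # map Sym rs = (a @ [Sym x]) @ Head q0 # b"
      by simp
    from unique_head[OF this] have *: "a @ [Sym x] = map Sym (rev ls)" "q0 = q" "b = map Sym rs"
      by simp_all
    from *(1) obtain ls' where "ls = x # ls'" "a = map Sym (rev ls')"
      by (cases ls) auto
    with * c d w True show ?thesis
      by (intro exI[of _ "(rev u @ ls', q', v @ rs)"]) simp
  next
    case False
    with e c have "map Sym (rev ls) @ Head q # map Sym rs = a @ Head q0 # Sym x # b"
      by simp
    from unique_head[OF this] have *: "a = map Sym (rev ls)" "q0 = q" "Sym x # b = map Sym rs"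
      by simp_all
    from *(3) obtain rs' where "rs = x # rs'" "b = map Sym rs'"
      by (cases rs) auto
    with * c d w False show ?thesis
      by (intro exI[of _ "(rev u @ ls, q', v @ rs')"]) simp
  qed
qed

lemma rewrites_iff_reaches: "(rewrite rules)\<^sup>*\<^sup>* (word c) (word d) \<longleftrightarrow> reaches c d"
proof
  have inj: "c = d" if "word c = word d" for c d
  proof -
    obtain ls q rs ls' q' rs' where cd: "c = (ls, q, rs)" "d = (ls', q', rs')"
      by (cases c, cases d)
    with that have "map Sym (rev ls) @ Head q # map Sym rs = map Sym (rev ls') @ Head q' # map Sym rs'"
      by simp
    from unique_head[OF this] have "ls' = ls \<and> q' = q \<and> rs' = rs"
      by (auto simp: inj_def)
    with cd show ?thesis by simp
  qed
  assume "(rewrite rules)\<^sup>*\<^sup>* (word c) (word d)"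
  moreover have "\<exists>e. w = word e \<and> reaches c e" if "(rewrite rules)\<^sup>*\<^sup>* (word c) w" for w
    using that
  proof (induction rule: rtranclp_induct)
    case base
    then show ?case by blast
  next
    case (step w w')
    then obtain e where "w = word e" "reaches c e" by blast
    moreover from this obtain d where "move e = Some d" "w' = word d"
      using rewrite_imp_move step.hyps(2) by blast
    ultimately have "w' = word d" "reaches c d"
      by (simp_all add: rtranclp.rtrancl_into_rtrancl)
    then show ?case by blast
  qed
  ultimately show "reaches c d" using inj by blast
next
  assume "reaches c d"
  then show "(rewrite rules)\<^sup>*\<^sup>* (word c) (word d)"
    by (induction rule: rtranclp_induct) (auto intro: rtranclp.rtrancl_into_rtrancl move_imp_rewrite)
qed

text \<open>Along the run to \<open>e\<close> the configuration \<open>d\<close> always lies ahead: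
  the next configuration is forced, and \<open>d\<close> itself has none.\<close>

lemma reaches_terminal_unique:
  assumes "reaches c d" "reaches c e" "move d = None" "move e = None"
  shows "d = e"
proof -
  have "reaches e d"
    using assms(2,1)
  proof (induction rule: rtranclp_induct)
    case (step x y)
    from step.IH[OF step.prems] step.hyps(2) assms(3) show ?case
      by (auto elim: converse_rtranclpE)
  qed
  with assms(4) show ?thesis by (auto elim: converse_rtranclpE)
qed

section \<open>Finiteness of the rule set\<close>

lemma finite_sym: "finite (UNIV :: sym set)"
proof -
  let ?S = "{One, Bar, At, Semi, Caret, Plus, Minus, ToLeft, ToRight, Open, Active, Close, Mark,
    Count, LeftEnd, RightEnd}"
  have "x \<in> ?S" for x
    by (cases x) auto
  then show ?thesis by (intro finite_subset[of UNIV ?S]) blast+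
qed

lemma finite_state: "finite (UNIV :: state set)"
proof -
  let ?R = "{Proceed, Enter, Skip}"
  have "x \<in> ?R" for x
    by (cases x) auto
  then have "finite (UNIV :: reply set)" by (intro finite_subset[of UNIV ?R]) blast+
  moreover let ?S = "{Run, Back, Remove, GoLeft, GoRight, Test, Scan, Decrement, Unmark, Final,
    EraseRight, EraseLeft, Accept, Reject} \<union> range Find \<union> range Carry \<union> range Return \<union> range Resume"
  have "x \<in> ?S" for x
    by (cases x) auto
  then have "UNIV \<subseteq> ?S" by blast
  ultimately show ?thesis
    using finite_sym by (elim finite_subset) simp
qed

lemma finite_letter: "finite (UNIV :: letter set)"
proof -
  have "x \<in> range Sym \<union> range Head" for x
    by (cases x) auto
  then have "UNIV \<subseteq> range Sym \<union> range Head" by blast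
  then show ?thesis
    using finite_sym finite_state by (elim finite_subset) simp
qed

lemma finite_rules: "finite rules"
proof -
  define F where "F = (\<lambda>(q, x). case delta q x of None \<Rightarrow> ([], []) | Some (u, q', v) \<Rightarrow>
    (if reads_left q then [Sym x, Head q] else [Head q, Sym x], map Sym u @ Head q' # map Sym v))"
  have "rules \<subseteq> range F"
  proof
    fix r assume "r \<in> rules"
    then obtain q x u q' v where "delta q x = Some (u, q', v)"
      "r = (if reads_left q then [Sym x, Head q] else [Head q, Sym x], map Sym u @ Head q' # map Sym v)"
      unfolding rules_def by blast
    then have "r = F (q, x)"
      by (simp add: F_def)
    then show "r \<in> range F" by blast
  qed
  moreover have "finite (UNIV :: (state \<times> sym) set)"
    using finite_sym finite_state by (simp add: finite_Prod_UNIV)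
  ultimately show ?thesis by (meson finite_imageI finite_subset)
qed

lemma rules_nonempty: "(l, r) \<in> rules \<Longrightarrow> l \<noteq> [] \<and> r \<noteq> []"
  by (auto simp: rules_def split: if_splits)

section \<open>Computing the instances\<close>

definition computable :: "(nat \<Rightarrow> nat) \<Rightarrow> bool" where
  "computable f \<longleftrightarrow> (\<exists>r. \<forall>x. computes r [x] (f x))"

lemma computes_Comp1:
  "computes g xs y \<Longrightarrow> computes f [y] z \<Longrightarrow> computes (Comp f [g]) xs z"
  by (rule computes.comp[of _ _ "[y]"]) auto

lemma computes_Comp2:
  "computes g xs y \<Longrightarrow> computes h xs y' \<Longrightarrow> computes f [y, y'] z \<Longrightarrow> computes (Comp f [g, h]) xs z"
  by (rule computes.comp[of _ _ "[y, y']"]) auto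

lemma computes_Proj:
  "computes (Proj 0) (x # xs) x" "computes (Proj (Suc 0)) (x # y # xs) y"
  using computes.proj[of 0 "x # xs"] computes.proj[of 1 "x # y # xs"] by simp_all

lemma computable_id: "computable (\<lambda>x. x)"
  unfolding computable_def using computes_Proj by blast

lemma computable_Suc: "computable f \<Longrightarrow> computable (\<lambda>x. Suc (f x))"
  unfolding computable_def by (metis computes_Comp1 computes.succ)

lemma computable_const: "computable (\<lambda>x. c)"
proof (induction c)
  case 0
  then show ?case unfolding computable_def using computes.zero by blast
next
  case (Suc c)
  then show ?case by (rule computable_Suc)
qed

lemma computable_comp2:
  assumes "\<And>x y. computes r [x, y] (g x y)" "computable f" "computable f'"
  shows "computable (\<lambda>x. g (f x) (f' x))"
proof -
  from assms(2,3) obtain s s' where "\<And>x. computes s [x] (f x)" "\<And>x. computes s' [x] (f' x)"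
    unfolding computable_def by blast
  then have "computes (Comp r [s, s']) [x] (g (f x) (f' x))" for x
    using assms(1) by (intro computes_Comp2)
  then show ?thesis unfolding computable_def by blast
qed

text \<open>The step function receives the round, the previous value and \<open>x\<close>, and only
  uses the second. This yields both addition and the \<open>n\<close>-fold prefix of a coded
  word.\<close>

lemma computes_iterate:
  assumes "\<And>x. computes r [x] (f x)"
  shows "computes (PrimRec (Proj 0) (Comp r [Proj 1])) [n, x] ((f ^^ n) x)"
proof (induction n)
  case 0
  show ?case by (auto intro: computes.primrec_0 computes_Proj)
next
  case (Suc n)
  have "computes (Comp r [Proj 1]) [n, (f ^^ n) x, x] (f ((f ^^ n) x))"
    using assms by (auto intro: computes_Comp1 computes_Proj)
  with Suc show ?case by (auto intro: computes.primrec_Suc)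
qed

lemma computable_iterate:
  assumes "computable f" "computable g" "computable h"
  shows "computable (\<lambda>x. (f ^^ g x) (h x))"
proof -
  from assms(1) obtain r where "\<And>x. computes r [x] (f x)"
    unfolding computable_def by blast
  from computable_comp2[OF computes_iterate[OF this] assms(2,3)] show ?thesis .
qed

lemma computable_add: "computable f \<Longrightarrow> computable g \<Longrightarrow> computable (\<lambda>x. f x + g x)"
  using computable_iterate[of Suc f g] computable_Suc[OF computable_id] by simp

lemma computable_triangle: "computable f \<Longrightarrow> computable (\<lambda>x. triangle (f x))"
proof -
  obtain a where a: "\<And>x y. computes a [x, y] (x + y)"
    using computes_iterate[of Succ Suc] computes.succ by (metis Suc_funpow)
  have "computes (PrimRec Zero (Comp Succ [Comp a [Proj 0, Proj 1]])) [n] (triangle n)" for n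
  proof (induction n)
    case 0
    show ?case by (auto intro: computes.primrec_0 computes.zero)
  next
    case (Suc n)
    have "computes (Comp Succ [Comp a [Proj 0, Proj 1]]) [n, triangle n] (Suc (n + triangle n))"
      using computes_Proj a by (intro computes_Comp1[OF computes_Comp2 computes.succ]) auto
    from computes.primrec_Suc[OF Suc this] show ?case by (simp add: add.commute)
  qed
  moreover assume "computable f"
  ultimately show "computable (\<lambda>x. triangle (f x))"
    unfolding computable_def by (blast intro: computes_Comp1)
qed

lemma computable_prod_encode:
  "computable f \<Longrightarrow> computable g \<Longrightarrow> computable (\<lambda>x. prod_encode (f x, g x))"
  unfolding prod_encode_def by (simp add: computable_add computable_triangle)

text \<open>Prepends the word \<open>w\<close> to a list given by its code \<open>n\<close>. The
  list itself is never decoded, so an instance can be computed from the code of its final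
  part.\<close>

definition cons_code :: "nat list \<Rightarrow> nat \<Rightarrow> nat" where
  "cons_code w n = foldr (\<lambda>c n. Suc (prod_encode (c, n))) w n"

lemma list_encode_append: "list_encode (w @ xs) = cons_code w (list_encode xs)"
  by (induction w) (auto simp: cons_code_def)

lemma cons_code_replicate: "cons_code (concat (replicate k w)) n = (cons_code w ^^ k) n"
  by (induction k) (auto simp: cons_code_def)

lemma computable_cons_code: "computable f \<Longrightarrow> computable (\<lambda>x. cons_code w (f x))"
  by (induction w) (auto simp: cons_code_def intro!: computable_Suc computable_prod_encode computable_const)

section \<open>Undecidability\<close>

definition accept_word :: "letter option list" where
  "accept_word = map Some (word ([], Accept, [])) @ [None]"

definition fixed_pairs :: "(letter option marked list \<times> letter option marked list) set" where
  "fixed_pairs = insert (end_pair accept_word []) (mark_pair ` rewrite_pairs rules)"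

definition input_pair :: "letter list \<Rightarrow> letter option marked list \<times> letter option marked list" where
  "input_pair w = start_pair [] (map Some w @ [None])"

lemma finite_fixed_pairs: "finite fixed_pairs"
proof -
  have "(UNIV :: letter option set) = insert None (range Some)"
    by (auto simp: not_None_eq image_iff intro: option.exhaust)
  then have "finite (UNIV :: letter option set)"
    using finite_letter by (metis finite_imageI finite_insert)
  then show ?thesis
    using finite_rules by (simp add: fixed_pairs_def rewrite_pairs_def)
qed

lemma rewrite_pairs_nonempty: "(u, v) \<in> rewrite_pairs rules \<Longrightarrow> u \<noteq> [] \<and> v \<noteq> []"
  using rules_nonempty by (auto simp: rewrite_pairs_def)

text \<open>The differing first letters give distinct components, and they separate these pairs from
  the input pair, where both sides begin with \<open>Dollar\<close>.\<close>

lemma fixed_pairs_hd: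
  assumes "q \<in> fixed_pairs"
  shows "\<exists>x u v. q = (Ch x # u, Hash # v)"
  using assms unfolding fixed_pairs_def
proof (elim insertE imageE)
  assume "q = end_pair accept_word []"
  then show ?thesis by (simp add: end_pair_def accept_word_def)
next
  fix p assume p: "q = mark_pair p" "p \<in> rewrite_pairs rules"
  obtain u v where uv: "p = (u, v)" by (cases p)
  with p(2) rewrite_pairs_nonempty have "u \<noteq> []" "v \<noteq> []" by blast+
  with p(1) uv show ?thesis
    using after_Cons before_Cons by (fastforce simp: mark_pair_def)
qed

lemma solution_iff_reaches:
  defines "G w \<equiv> insert (input_pair w) fixed_pairs"
  shows "(\<exists>qs. qs \<noteq> [] \<and> set qs \<subseteq> G w \<union> (G w)\<inverse> \<and> concat (map fst qs) = concat (map snd qs)) \<longleftrightarrow>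
    (rewrite rules)\<^sup>*\<^sup>* w (word ([], Accept, []))"
  unfolding G_def input_pair_def fixed_pairs_def rewrites_iff_pairs accept_word_def
  by (rule symmetric_solution_iff) (rule rewrite_pairs_nonempty)

definition marked_num :: "('b \<Rightarrow> nat) \<Rightarrow> 'b marked \<Rightarrow> nat" where
  "marked_num f x = (case x of Ch c \<Rightarrow> f c + 3 | Hash \<Rightarrow> 0 | Dollar \<Rightarrow> 1 | Fin \<Rightarrow> 2)"

lemma inj_marked_num: "inj f \<Longrightarrow> inj (marked_num f)"
  by (auto simp: inj_def marked_num_def split: marked.splits)

text \<open>An injective morphism of words preserves and reflects solutions.\<close>

lemma coded_solution_iff:
  assumes "inj h" "h [] = []" "\<And>xs ys. h (xs @ ys) = h xs @ h ys"
  shows "(\<exists>qs. qs \<noteq> [] \<and> set qs \<subseteq> map_prod h h ` S \<and> concat (map fst qs) = concat (map snd qs)) \<longleftrightarrow>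
    (\<exists>qs. qs \<noteq> [] \<and> set qs \<subseteq> S \<and> concat (map fst qs) = concat (map snd qs))"
proof -
  have h: "concat (map fst (map (map_prod h h) qs)) = h (concat (map fst qs))"
    "concat (map snd (map (map_prod h h) qs)) = h (concat (map snd qs))" for qs
    using assms(2,3) by (induction qs) auto
  show ?thesis
  proof
    assume "\<exists>qs. qs \<noteq> [] \<and> set qs \<subseteq> map_prod h h ` S \<and> concat (map fst qs) = concat (map snd qs)"
    then obtain qs where qs: "qs \<noteq> []" "set qs \<subseteq> map_prod h h ` S"
      "concat (map fst qs) = concat (map snd qs)"
      by blast
    from qs(2) have "qs \<in> map (map_prod h h) ` lists S"
      by (auto simp flip: lists_image)
    then obtain ps where ps: "set ps \<subseteq> S" "qs = map (map_prod h h) ps"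
      by (auto simp: lists_eq_set)
    with qs h[of ps] assms(1) have "concat (map fst ps) = concat (map snd ps)"
      by (simp add: inj_eq del: map_map)
    with qs(1) ps show "\<exists>qs. qs \<noteq> [] \<and> set qs \<subseteq> S \<and> concat (map fst qs) = concat (map snd qs)"
      by auto
  next
    assume "\<exists>qs. qs \<noteq> [] \<and> set qs \<subseteq> S \<and> concat (map fst qs) = concat (map snd qs)"
    then obtain qs where qs: "qs \<noteq> []" "set qs \<subseteq> S" "concat (map fst qs) = concat (map snd qs)"
      by blast
    then have "map (map_prod h h) qs \<noteq> []" "set (map (map_prod h h) qs) \<subseteq> map_prod h h ` S"
      "concat (map fst (map (map_prod h h) qs)) = concat (map snd (map (map_prod h h) qs))"
      unfolding h by auto
    then show "\<exists>qs. qs \<noteq> [] \<and> set qs \<subseteq> map_prod h h ` S \<and> concat (map fst qs) = concat (map snd qs)"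
      by blast
  qed
qed

theorem proposition2p1:
  fixes A :: "'a set"
  assumes "finite A" and "card A \<ge> 2"
  shows "\<exists>K::nat. bounded_symmetric_pcp_undecidable A K"
proof -
  from assms(2) have "\<not> (\<exists>a. A \<subseteq> {a})"
    using card_mono[of "{_}" A] by fastforce
  then obtain a b where ab: "a \<in> A" "b \<in> A" "a \<noteq> b"
    by blast
  obtain f :: "letter \<Rightarrow> nat" where "inj f"
    using finite_letter finite_imp_inj_to_nat_seg by metis
  define g :: "letter option marked \<Rightarrow> nat" where
    "g = marked_num (\<lambda>x. case x of None \<Rightarrow> 0 | Some c \<Rightarrow> Suc (f c))"
  have "inj g"
    unfolding g_def using \<open>inj f\<close> by (intro inj_marked_num) (auto simp: inj_def split: option.splits)
  define h where "h = block_code a b g"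
  have h: "inj h" "h [] = []" "h (xs @ ys) = h xs @ h ys" for xs ys
    using inj_block_code[OF \<open>a \<noteq> b\<close> \<open>inj g\<close>] by (simp_all add: h_def block_code_def)
  have h_eq: "h xs = h ys \<longleftrightarrow> xs = ys" for xs ys
    using h(1) by (simp add: inj_eq)
  define S where "S w = insert (input_pair w) fixed_pairs" for w
  define H where "H = map_prod h h"
  obtain fl where fl: "set fl = H ` (fixed_pairs \<union> fixed_pairs\<inverse>)" "distinct fl"
    using finite_distinct_list[of "H ` (fixed_pairs \<union> fixed_pairs\<inverse>)"] finite_fixed_pairs by auto
  \<comment> \<open>The list \<open>fl\<close> is fixed once and for all, which gives the bound
    \<open>length fl + 2\<close>. The pairs that vary stand at the front, so \<open>rest\<close>
    below is a constant of the instance code.\<close>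
  define inst where "inst w = H (input_pair w) # H (prod.swap (input_pair w)) # fl" for w
  have set_inst: "set (inst w) = H ` (S w \<union> (S w)\<inverse>)" for w
    unfolding inst_def S_def by (auto simp: fl(1) converse_eq_swap)
  have neq: "fst q \<noteq> snd q" if "q \<in> S w \<union> (S w)\<inverse>" for q w
  proof -
    have "fst q \<noteq> snd q" if "q \<in> S w" for q
      using that fixed_pairs_hd[of q]
      by (cases w) (auto simp: S_def input_pair_def start_pair_def)
    with that show ?thesis by (cases q) force
  qed
  have input: "symmetric_pcp_input A (inst w)" for w
  proof -
    have "set (inst w) \<subseteq> lists A \<times> lists A"
      unfolding set_inst H_def h_def using ab block_code_in_lists by fastforce
    moreover have "fst q \<noteq> snd q" if "q \<in> set (inst w)" for q
    proof -
      from that obtain q' where "q' \<in> S w \<union> (S w)\<inverse>" "q = H q'"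
        unfolding set_inst by blast
      with neq[of q' w] show ?thesis
        by (cases q') (simp add: H_def h_eq)
    qed
    moreover have "distinct (inst w)"
    proof -
      have inj: "H p = H q \<longleftrightarrow> p = q" for p q
        by (cases p; cases q) (simp add: H_def h_eq)
      have "fst q \<noteq> Dollar # u" if "q \<in> fixed_pairs \<union> fixed_pairs\<inverse>" for q u
        using that fixed_pairs_hd by (cases q) fastforce
      then have "input_pair w \<notin> fixed_pairs \<union> fixed_pairs\<inverse>"
        "prod.swap (input_pair w) \<notin> fixed_pairs \<union> fixed_pairs\<inverse>"
        by (force simp: input_pair_def start_pair_def)+
      moreover have "input_pair w \<noteq> prod.swap (input_pair w)"
        using neq[of "input_pair w" w] by (auto simp: S_def prod_eq_iff)
      ultimately show ?thesis
        by (auto simp: inst_def fl inj simp del: Un_iff)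
    qed
    moreover have "sym (set (inst w))"
      unfolding set_inst H_def by (auto simp: sym_def)
    moreover have "inst w \<noteq> []"
      by (simp add: inst_def)
    ultimately show ?thesis
      unfolding symmetric_pcp_input_def pcp_input_def using nth_mem by blast
  qed
  have solvable: "pcp_solvable (inst (word c)) \<longleftrightarrow> reaches c ([], Accept, [])" for c
    by (simp only: pcp_solvable_iff set_inst H_def coded_solution_iff[OF h] S_def solution_iff_reaches
      rewrites_iff_reaches)
  have "\<not> decidable_problem (pcp_code num)
      {ps. symmetric_pcp_input A ps \<and> length ps \<le> length fl + 2} pcp_solvable" for num :: "'a \<Rightarrow> nat"
  proof
    have "inst w \<in> {ps. symmetric_pcp_input A ps \<and> length ps \<le> length fl + 2}" for w
      using input by (simp add: inst_def)
    moreover assume "decidable_problem (pcp_code num)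
      {ps. symmetric_pcp_input A ps \<and> length ps \<le> length fl + 2} pcp_solvable"
    ultimately obtain r where r: "computes r [pcp_code num (inst w)] (if pcp_solvable (inst w) then 1 else 0)" for w
      unfolding decidable_problem_def by blast
    define e where "e xs = map num (h xs)" for xs
    define first where "first = list_encode (e [Dollar, Hash])"
    define rest where "rest = list_encode
      (map (\<lambda>(u, v). prod_encode (list_encode (map num u), list_encode (map num v))) fl)"
    \<comment> \<open>Here \<open>n\<close> is used twice: as the number of \<open>One\<close>
      letters on the tape and as the code of everything behind them.\<close>
    define second where "second n = cons_code (e (Dollar # before [Some (Sym LeftEnd)]))
      ((cons_code (e (before [Some (Sym One)])) ^^ n) n)" for n
    have "computable (\<lambda>n. Suc (prod_encode (prod_encode (first, second n),
        Suc (prod_encode (prod_encode (second n, first), rest)))))"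
      unfolding second_def
      by (intro computable_Suc computable_prod_encode computable_const computable_cons_code
          computable_iterate computable_id)
    then obtain s where s: "computes s [n] (Suc (prod_encode (prod_encode (first, second n),
        Suc (prod_encode (prod_encode (second n, first), rest)))))" for n
      unfolding computable_def by blast
    define p where "p = Comp r [s]"
    define tail where "tail = [Sym At, Sym Semi, Head Run] @ map Sym (main_program p @ [RightEnd])"
    \<comment> \<open>The word \<open>tail\<close> contains the program \<open>p\<close> but not its
      input, so \<open>n\<close> can be defined from \<open>p\<close> without circularity. With this
      choice \<open>s\<close> maps \<open>n\<close> to the code of the instance asking whether
      \<open>p\<close> returns 0 on \<open>n\<close>.\<close>
    define n where "n = list_encode (e (before (map Some tail @ [None])))"
    define c where "c = (tape 1 0 ((\<lambda>_. 0)(0 := n)), Run, main_program p @ [RightEnd])"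
    have word: "word c = Sym LeftEnd # replicate n (Sym One) @ tail"
      by (simp add: c_def tape_def cells_right_Nil tail_def)
    have e: "e (xs @ ys) = e xs @ e ys" for xs ys
      by (simp add: e_def h)
    have e_replicate: "e (before (map Some (replicate k x))) = concat (replicate k (e (before [Some x])))" for k x
    proof (induction k)
      case (Suc k)
      have "before (map Some (replicate (Suc k) x)) = before [Some x] @ before (map Some (replicate k x))"
        by simp
      then show ?case by (simp only: e Suc.IH replicate_Suc concat.simps)
    qed (simp add: e_def h)
    have "list_encode (e (Dollar # before (map Some (word c) @ [None]))) = second n"
    proof -
      have "Dollar # before (map Some (word c) @ [None]) = (Dollar # before [Some (Sym LeftEnd)])
          @ before (map Some (replicate n (Sym One))) @ before (map Some tail @ [None])"
        by (simp add: word)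
      then show ?thesis
        unfolding second_def by (simp only: e list_encode_append cons_code_replicate e_replicate n_def)
    qed
    then have "pcp_code num (inst (word c)) = Suc (prod_encode (prod_encode (first, second n),
        Suc (prod_encode (prod_encode (second n, first), rest))))"
      by (simp add: pcp_code_def inst_def H_def input_pair_def start_pair_def first_def rest_def e_def)
    with s[of n] r[of "word c"] have "computes p [n] (if pcp_solvable (inst (word c)) then 1 else 0)"
      unfolding p_def by (intro computes_Comp1) auto
    \<comment> \<open>A solvable instance makes \<open>p\<close> return 1 and the interpreter
      reject; an unsolvable one makes it accept. Either contradicts \<open>solvable\<close>, the
      first one because terminal configurations are unique.\<close>
    from computes_reaches[OF this] obtain ls rs where *: "reaches c
        (if pcp_solvable (inst (word c)) then (ls, Reject, rs) else ([], Accept, []))"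
      unfolding c_def by (auto split: if_splits)
    have "move (ls, Reject, rs) = None" "move ([], Accept, []) = None"
      by (simp_all add: move_def split: list.split)
    with * solvable[of c] reaches_terminal_unique[of c "(ls, Reject, rs)" "([], Accept, [])"]
    show False by (auto split: if_splits)
  qed
  then show ?thesis
    unfolding bounded_symmetric_pcp_undecidable_def by blast
qed

end
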